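(* Two finite acyclic categories $\mathcal{A}$ and $\mathcal{B}$ have the same strong equivalence type if and only if they are strongly homotopy equivalent ($\mathcal{A}\simeq\mathcal{B}$).
   Context: A category $\mathcal{A}$ is acyclic if (i) for objects $x\neq y$, $\mathcal{A}(y,x)\neq\emptyset$ implies $\mathcal{A}(x,y)=\emptyset$, and (ii) every endomorphism is an identity. All acyclic categories considered are finite (finitely many objects and morphisms). Two functors $F,G\colon\mathcal{A}\to\mathcal{B}$ are homotopic, $F\simeq G$, if there is a finite zigzag of functors and natural transformations $F=H_0\Rightarrow H_1\Leftarrow H_2\Rightarrow\cdots\Rightarrow H_n=G$. $\mathcal{A}$ and $\mathcal{B}$ are strongly homotopy equivalent, $\mathcal{A}\simeq\mathcal{B}$, if there are functors $F\colon\mathcal{A}\to\mathcal{B}$ and $G\colon\mathcal{B}\to\mathcal{A}$ with $G\circ F\simeq 1_{\mathcal{A}}$ and $F\circ G\simeq 1_{\mathcal{B}}$. An object $x$ is a down beat object if there is a non-identity morphism $f\colon y\to x$ such that every non-identity morphism $g\colon z\to x$ factors as $g=f\circ\tilde g$ for a unique $\tilde g\colon z\to y$; up beat objects are down beat objects of $\mathcal{A}^{\mathrm{op}}$; a beat object is a down or up beat object. $\mathcal{A}\setminus x$ is the full subcategory on all objects other than $x$. If $x$ is a beat object of $\mathcal{A}$, there is an elementary strong collapse from $\mathcal{A}$ to $\mathcal{A}\setminus x$. For a full subcategory $\mathcal{B}$ of $\mathcal{A}$, write $\mathcal{A}\searrow\!\!\!\searrow\mathcal{B}$ (strong collapse)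 if there is a (possibly empty) finite sequence of elementary strong collapses starting in $\mathcal{A}$ and ending in $\mathcal{B}$. $\mathcal{A}$ and $\mathcal{B}$ have the same strong equivalence type if there is a finite sequence of acyclic categories $\mathcal{A}=\mathcal{C}_0,\mathcal{C}_1,\dots,\mathcal{C}_n=\mathcal{B}$ such that, for each $i$, $\mathcal{C}_i\searrow\!\!\!\searrow\mathcal{C}_{i+1}$ or $\mathcal{C}_{i+1}\searrow\!\!\!\searrow\mathcal{C}_i$. *)

theory Defs
  imports Main "HOL-Library.FuncSet"
begin

record ('o, 'm) category =
  Obj :: "'o set"
  Arr :: "'m set"
  Dom :: "'m \<Rightarrow> 'o"
  Cod :: "'m \<Rightarrow> 'o"
  Ident :: "'o \<Rightarrow> 'm"
  Comp :: "'m \<Rightarrow> 'm \<Rightarrow> 'm"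

definition hom_set :: "('o, 'm) category \<Rightarrow> 'o \<Rightarrow> 'o \<Rightarrow> 'm set" where
  "hom_set C x y = {f \<in> Arr C. Dom C f = x \<and> Cod C f = y}"

definition composable :: "('o, 'm) category \<Rightarrow> 'm \<Rightarrow> 'm \<Rightarrow> bool" where
  "composable C g f \<longleftrightarrow> f \<in> Arr C \<and> g \<in> Arr C \<and> Cod C f = Dom C g"

text \<open>\<open>Comp C g f\<close> is \<open>g \<circ> f\<close>. The structure maps are required to be \<open>undefined\<close> outside their
  mathematical domains, so that HOL equality of records is equality of categories.\<close>

locale category =
  fixes C :: "('o, 'm) category"
  assumes Dom_PiE: "Dom C \<in> Arr C \<rightarrow>\<^sub>E Obj C"
    and Cod_PiE: "Cod C \<in> Arr C \<rightarrow>\<^sub>E Obj C"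
    and Ident_ext: "Ident C \<in> extensional (Obj C)"
    and Ident_hom: "x \<in> Obj C \<Longrightarrow> Ident C x \<in> hom_set C x x"
    and Comp_ext: "\<not> composable C g f \<Longrightarrow> Comp C g f = undefined"
    and Comp_hom: "f \<in> hom_set C x y \<Longrightarrow> g \<in> hom_set C y z \<Longrightarrow> Comp C g f \<in> hom_set C x z"
    and Comp_Ident_left: "f \<in> hom_set C x y \<Longrightarrow> Comp C (Ident C y) f = f"
    and Comp_Ident_right: "f \<in> hom_set C x y \<Longrightarrow> Comp C f (Ident C x) = f"
    and Comp_assoc: "f \<in> hom_set C w x \<Longrightarrow> g \<in> hom_set C x y \<Longrightarrow> h \<in> hom_set C y z \<Longrightarrow>
      Comp C h (Comp C g f) = Comp C (Comp C h g) f"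

locale acyclic_category = category +
  assumes hom_antisym:
      "x \<in> Obj C \<Longrightarrow> y \<in> Obj C \<Longrightarrow> x \<noteq> y \<Longrightarrow> hom_set C y x \<noteq> {} \<Longrightarrow> hom_set C x y = {}"
    and endo_Ident: "x \<in> Obj C \<Longrightarrow> f \<in> hom_set C x x \<Longrightarrow> f = Ident C x"

locale finite_acyclic_category = acyclic_category +
  assumes finite_Obj: "finite (Obj C)"
    and finite_Arr: "finite (Arr C)"

definition opposite :: "('o, 'm) category \<Rightarrow> ('o, 'm) category" where
  "opposite C = \<lparr>Obj = Obj C, Arr = Arr C, Dom = Cod C, Cod = Dom C, Ident = Ident C,
    Comp = (\<lambda>g f. Comp C f g)\<rparr>"

definition full_subcategory :: "('o, 'm) category \<Rightarrow> 'o set \<Rightarrow> ('o, 'm) category" where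
  "full_subcategory C S =
    (let Ob = Obj C \<inter> S; Ar = {f \<in> Arr C. Dom C f \<in> S \<and> Cod C f \<in> S} in
     \<lparr>Obj = Ob, Arr = Ar,
      Dom = restrict (Dom C) Ar, Cod = restrict (Cod C) Ar,
      Ident = restrict (Ident C) Ob,
      Comp = (\<lambda>g f. if f \<in> Ar \<and> g \<in> Ar then Comp C g f else undefined)\<rparr>)"

text \<open>Functors are not required to be extensional: their values outside \<open>Obj A\<close> and \<open>Arr A\<close> are
  irrelevant, and functors that agree on \<open>A\<close> are linked by an identity natural transformation.\<close>

record ('o, 'm, 'p, 'n) functor_maps =
  omap :: "'o \<Rightarrow> 'p"
  amap :: "'m \<Rightarrow> 'n"

definition is_functor ::
  "('o, 'm) category \<Rightarrow> ('p, 'n) category \<Rightarrow> ('o, 'm, 'p, 'n) functor_maps \<Rightarrow> bool" where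
  "is_functor A B F \<longleftrightarrow>
    (\<forall>x\<in>Obj A. omap F x \<in> Obj B) \<and>
    (\<forall>x\<in>Obj A. \<forall>y\<in>Obj A. \<forall>f\<in>hom_set A x y. amap F f \<in> hom_set B (omap F x) (omap F y)) \<and>
    (\<forall>x\<in>Obj A. amap F (Ident A x) = Ident B (omap F x)) \<and>
    (\<forall>g f. composable A g f \<longrightarrow> amap F (Comp A g f) = Comp B (amap F g) (amap F f))"

definition id_functor :: "('o, 'm, 'o, 'm) functor_maps" where
  "id_functor = \<lparr>omap = id, amap = id\<rparr>"

definition comp_functor :: "('p, 'n, 'q, 'l) functor_maps \<Rightarrow> ('o, 'm, 'p, 'n) functor_maps \<Rightarrow>
    ('o, 'm, 'q, 'l) functor_maps" where
  "comp_functor G F = \<lparr>omap = omap G \<circ> omap F, amap = amap G \<circ> amap F\<rparr>"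

definition natural_transformation :: "('o, 'm) category \<Rightarrow> ('p, 'n) category \<Rightarrow>
    ('o, 'm, 'p, 'n) functor_maps \<Rightarrow> ('o, 'm, 'p, 'n) functor_maps \<Rightarrow> ('o \<Rightarrow> 'n) \<Rightarrow> bool" where
  "natural_transformation A B F G \<eta> \<longleftrightarrow>
    is_functor A B F \<and> is_functor A B G \<and>
    (\<forall>x\<in>Obj A. \<eta> x \<in> hom_set B (omap F x) (omap G x)) \<and>
    (\<forall>x\<in>Obj A. \<forall>y\<in>Obj A. \<forall>f\<in>hom_set A x y.
      Comp B (\<eta> y) (amap F f) = Comp B (amap G f) (\<eta> x))"

definition homotopic :: "('o, 'm) category \<Rightarrow> ('p, 'n) category \<Rightarrow>
    ('o, 'm, 'p, 'n) functor_maps \<Rightarrow> ('o, 'm, 'p, 'n) functor_maps \<Rightarrow> bool" where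
  "homotopic A B F G \<longleftrightarrow>
    (\<exists>(n::nat) H. H 0 = F \<and> H n = G \<and> (\<forall>i\<le>n. is_functor A B (H i)) \<and>
      (\<forall>i<n. if even i then \<exists>\<eta>. natural_transformation A B (H i) (H (Suc i)) \<eta>
             else \<exists>\<eta>. natural_transformation A B (H (Suc i)) (H i) \<eta>))"

definition strongly_homotopy_equivalent ::
    "('o, 'm) category \<Rightarrow> ('p, 'n) category \<Rightarrow> bool" where
  "strongly_homotopy_equivalent A B \<longleftrightarrow>
    (\<exists>F G. is_functor A B F \<and> is_functor B A G \<and>
      homotopic A A (comp_functor G F) id_functor \<and>
      homotopic B B (comp_functor F G) id_functor)"

definition is_identity :: "('o, 'm) category \<Rightarrow> 'm \<Rightarrow> bool" where
  "is_identity C f \<longleftrightarrow> (\<exists>x\<in>Obj C. f = Ident C x)"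

definition down_beat_object :: "('o, 'm) category \<Rightarrow> 'o \<Rightarrow> bool" where
  "down_beat_object C x \<longleftrightarrow> x \<in> Obj C \<and>
    (\<exists>y\<in>Obj C. \<exists>f\<in>hom_set C y x. \<not> is_identity C f \<and>
      (\<forall>z\<in>Obj C. \<forall>g\<in>hom_set C z x. \<not> is_identity C g \<longrightarrow>
        (\<exists>!h. h \<in> hom_set C z y \<and> g = Comp C f h)))"

definition up_beat_object :: "('o, 'm) category \<Rightarrow> 'o \<Rightarrow> bool" where
  "up_beat_object C x \<longleftrightarrow> down_beat_object (opposite C) x"

definition beat_object :: "('o, 'm) category \<Rightarrow> 'o \<Rightarrow> bool" where
  "beat_object C x \<longleftrightarrow> down_beat_object C x \<or> up_beat_object C x"

definition elementary_strong_collapse ::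
    "('o, 'm) category \<Rightarrow> ('o, 'm) category \<Rightarrow> bool" where
  "elementary_strong_collapse A B \<longleftrightarrow>
    (\<exists>x. beat_object A x \<and> B = full_subcategory A (Obj A - {x}))"

definition strong_collapse :: "('o, 'm) category \<Rightarrow> ('o, 'm) category \<Rightarrow> bool" where
  "strong_collapse = elementary_strong_collapse\<^sup>*\<^sup>*"

text \<open>The intermediate categories are taken with objects in \<open>'o\<close> and morphisms in \<open>'m\<close>. When both
  types are infinite this is no restriction, since finite categories have room to expand inside
  them; over finite types the relation would be too small.\<close>

definition same_strong_equivalence_type ::
    "('o, 'm) category \<Rightarrow> ('o, 'm) category \<Rightarrow> bool" where
  "same_strong_equivalence_type A B \<longleftrightarrow>
    (\<exists>(n::nat) C. C 0 = A \<and> C n = B \<and> (\<forall>i\<le>n. finite_acyclic_category (C i)) \<and>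
      (\<forall>i<n. strong_collapse (C i) (C (Suc i)) \<or> strong_collapse (C (Suc i)) (C i)))"

end

theory Submission
  imports Defs
begin

text \<open>Removing a down beat object leaves a coreflective full subcategory, whose inclusion is a
  strong homotopy equivalence with the counit as homotopy; up beat objects are dual.

  Conversely, collapse \<open>A\<close> and \<open>B\<close> to categories \<open>A'\<close> and \<open>B'\<close> without beat objects. If
  \<open>\<eta>: F \<Rightarrow> 1\<close> on such a category were not the identity, then an object \<open>x\<close> minimal with
  \<open>F x \<noteq> x\<close> would be a down beat object via \<open>\<eta>\<^sub>x\<close>; hence only the identity is homotopic to the
  identity, and \<open>A'\<close> and \<open>B'\<close> are isomorphic. Isomorphic categories have the same strong
  equivalence type because disjoint copies of a category are the two ends of a cylinder
  \<open>A' \<times> {0 \<rightarrow> 1}\<close>, whose ends are coreflective and reflective; a coreflective subcategory is reached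
  by removing the remaining objects in increasing order, each being a down beat object at its turn.\<close>

subsection \<open>Categories, functors and full subcategories\<close>

text \<open>The delicate point is literal equality. An elementary collapse ends in one particular
  full subcategory, never in an isomorphic copy of it, and all categories of a zigzag share the
  types \<open>'o\<close> and \<open>'m\<close>. An isomorphism of the beat-free cores is therefore
  not yet a zigzag. The cylinder lives over product types, so its objects and arrows have to be
  renamed until its ends are the two given categories on the nose. The cores may overlap, so both
  are compared with a third copy disjoint from each.

  Coreflectivity is stated pointwise, by universal arrows, because the same data serve two purposes.
  In any category they assemble into a functor with a counit, which gives the homotopies. In a
  finite acyclic one they are beat arrows at suitably chosen objects, which gives the collapses.
  Both zigzag notions are first rewritten as equivalence closures, so that direction and length no
  longer matter.\<close>

lemma (in category) hom_Obj:
  assumes "f \<in> hom_set C x y"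
  shows "x \<in> Obj C" "y \<in> Obj C" "f \<in> Arr C" "Dom C f = x" "Cod C f = y"
  using assms Dom_PiE Cod_PiE by (auto simp: hom_set_def)

lemma (in category) Arr_hom: "f \<in> Arr C \<Longrightarrow> f \<in> hom_set C (Dom C f) (Cod C f)"
  by (simp add: hom_set_def)

lemma composable_iff:
  "composable C g f \<longleftrightarrow> (\<exists>x y z. f \<in> hom_set C x y \<and> g \<in> hom_set C y z)"
  by (auto simp: composable_def hom_set_def)

lemma functor_Obj: "is_functor A B F \<Longrightarrow> x \<in> Obj A \<Longrightarrow> omap F x \<in> Obj B"
  by (simp add: is_functor_def)

lemma functor_hom:
  "category A \<Longrightarrow> is_functor A B F \<Longrightarrow> f \<in> hom_set A x y \<Longrightarrow>
    amap F f \<in> hom_set B (omap F x) (omap F y)"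
  using category.hom_Obj[of A f x y] by (simp add: is_functor_def)

lemma functor_Arr:
  "category A \<Longrightarrow> is_functor A B F \<Longrightarrow> f \<in> Arr A \<Longrightarrow> amap F f \<in> Arr B"
  using functor_hom[OF _ _ category.Arr_hom] by (fastforce simp: hom_set_def)

lemma functor_Ident:
  "is_functor A B F \<Longrightarrow> x \<in> Obj A \<Longrightarrow> amap F (Ident A x) = Ident B (omap F x)"
  by (simp add: is_functor_def)

lemma functor_Comp:
  "is_functor A B F \<Longrightarrow> f \<in> hom_set A x y \<Longrightarrow> g \<in> hom_set A y z \<Longrightarrow>
    amap F (Comp A g f) = Comp B (amap F g) (amap F f)"
  using composable_iff[of A g f] by (auto simp: is_functor_def)

lemma is_functorI:
  assumes "\<And>x. x \<in> Obj A \<Longrightarrow> omap F x \<in> Obj B"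
    and "\<And>x y f. f \<in> hom_set A x y \<Longrightarrow> amap F f \<in> hom_set B (omap F x) (omap F y)"
    and "\<And>x. x \<in> Obj A \<Longrightarrow> amap F (Ident A x) = Ident B (omap F x)"
    and "\<And>x y z f g. f \<in> hom_set A x y \<Longrightarrow> g \<in> hom_set A y z \<Longrightarrow>
      amap F (Comp A g f) = Comp B (amap F g) (amap F f)"
  shows "is_functor A B F"
  using assms unfolding is_functor_def composable_iff by blast

lemma is_functor_cong:
  assumes "category A" and "is_functor A B F"
    and "\<And>x. x \<in> Obj A \<Longrightarrow> omap F' x = omap F x"
    and "\<And>f. f \<in> Arr A \<Longrightarrow> amap F' f = amap F f"
  shows "is_functor A B F'"
proof -
  interpret category A by fact
  have hom: "amap F' f = amap F f" if "f \<in> hom_set A x y" for f x y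
    using that assms(4) hom_Obj(3) by blast
  show ?thesis
  proof (rule is_functorI)
    fix x y f assume f: "f \<in> hom_set A x y"
    then show "amap F' f \<in> hom_set B (omap F' x) (omap F' y)"
      using functor_hom[OF assms(1,2) f] hom[OF f] assms(3) hom_Obj[OF f] by simp
    fix z g assume g: "g \<in> hom_set A y z"
    show "amap F' (Comp A g f) = Comp B (amap F' g) (amap F' f)"
      using functor_Comp[OF assms(2) f g] hom[OF f] hom[OF g] hom[OF Comp_hom[OF f g]] by simp
  qed (use assms(3) hom[OF Ident_hom] functor_Obj[OF assms(2)] functor_Ident[OF assms(2)] in simp_all)
qed

text \<open>Structure maps are \<open>undefined\<close> off their domains, so agreement on genuine
  objects, arrows and composable pairs is already equality of records. The identity functor packages
  this agreement.\<close>

lemma category_eqI: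
  assumes "category A" "category B" and "Obj A = Obj B" "Arr A = Arr B"
    and id: "is_functor A B id_functor"
  shows "A = B"
proof -
  interpret A: category A by fact
  interpret B: category B by fact
  have hom: "f \<in> hom_set B x y" if "f \<in> hom_set A x y" for f x y
    using functor_hom[OF assms(1) id that] by (simp add: id_functor_def)
  have DC: "Dom A f = Dom B f \<and> Cod A f = Cod B f" for f
  proof (cases "f \<in> Arr A")
    case True
    then show ?thesis using hom[OF A.Arr_hom] by (auto simp: hom_set_def)
  next
    case False
    then show ?thesis using A.Dom_PiE B.Dom_PiE A.Cod_PiE B.Cod_PiE assms(4)
      by (simp add: PiE_def extensional_def)
  qed
  have "Ident A x = Ident B x" for x
    using functor_Ident[OF id, of x] A.Ident_ext B.Ident_ext assms(3)
    by (cases "x \<in> Obj A") (auto simp: id_functor_def extensional_def)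
  moreover have "Comp A g f = Comp B g f" for g f
  proof (cases "composable A g f")
    case True
    then show ?thesis using id by (simp add: is_functor_def id_functor_def)
  next
    case False
    then have "\<not> composable B g f" using DC assms(4) by (simp add: composable_def)
    then show ?thesis using False A.Comp_ext B.Comp_ext by simp
  qed
  ultimately show ?thesis
    using assms(3,4) DC by (intro category.equality ext) auto
qed

lemma comp_functor_simps [simp]:
  "omap (comp_functor G F) x = omap G (omap F x)"
  "amap (comp_functor G F) f = amap G (amap F f)"
  "omap id_functor x = x" "amap id_functor f = f"
  "comp_functor id_functor F = F" "comp_functor F id_functor = F"
  by (simp_all add: comp_functor_def id_functor_def)

lemma comp_functor_assoc:
  "comp_functor (comp_functor H G) F = comp_functor H (comp_functor G F)"
  by (simp add: comp_functor_def comp_assoc)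

lemma is_functor_id [simp]: "is_functor A A id_functor"
  by (rule is_functorI) simp_all

lemma is_functor_comp:
  assumes "category A" "category B" "is_functor A B F" "is_functor B C G"
  shows "is_functor A C (comp_functor G F)"
proof (rule is_functorI; simp)
  fix x y f assume f: "f \<in> hom_set A x y"
  note Ff = functor_hom[OF assms(1,3) f]
  then show "amap G (amap F f) \<in> hom_set C (omap G (omap F x)) (omap G (omap F y))"
    using functor_hom[OF assms(2,4)] by blast
  fix z g assume g: "g \<in> hom_set A y z"
  show "amap G (amap F (Comp A g f)) = Comp C (amap G (amap F g)) (amap G (amap F f))"
    using functor_Comp[OF assms(4) Ff functor_hom[OF assms(1,3) g]] functor_Comp[OF assms(3) f g]
    by simp
qed (use assms in \<open>simp_all add: functor_Obj functor_Ident\<close>)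

section \<open>Opposite categories\<close>

lemma hom_opposite [simp]: "hom_set (opposite C) x y = hom_set C y x"
  by (auto simp: hom_set_def opposite_def)

lemma opposite_simps [simp]:
  "Obj (opposite C) = Obj C" "Arr (opposite C) = Arr C" "Ident (opposite C) = Ident C"
  "Comp (opposite C) g f = Comp C f g" "opposite (opposite C) = C"
  by (simp_all add: opposite_def)

lemma category_opposite:
  assumes "category C"
  shows "category (opposite C)"
proof -
  interpret category C by fact
  show ?thesis
  proof
    fix g f assume "\<not> composable (opposite C) g f"
    then have "\<not> composable C f g"
      by (auto simp: composable_def opposite_def)
    then show "Comp (opposite C) g f = undefined"
      using Comp_ext by simp
  next
    fix w x y z f g h
    assume "f \<in> hom_set (opposite C) w x" "g \<in> hom_set (opposite C) x y"
      "h \<in> hom_set (opposite C) y z"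
    then show "Comp (opposite C) h (Comp (opposite C) g f) = Comp (opposite C) (Comp (opposite C) h g) f"
      using Comp_assoc[of h z y g x f w] by simp
  qed (use Dom_PiE Cod_PiE in \<open>simp_all add: Ident_ext Ident_hom Comp_hom Comp_Ident_left
    Comp_Ident_right\<close>, simp_all add: opposite_def)
qed

lemma finite_acyclic_category_opposite:
  assumes "finite_acyclic_category C"
  shows "finite_acyclic_category (opposite C)"
proof -
  interpret finite_acyclic_category C by fact
  interpret op: category "opposite C" using category_axioms by (rule category_opposite)
  show ?thesis
    by unfold_locales (use hom_antisym endo_Ident finite_Obj finite_Arr in auto)
qed

lemma is_functor_opposite:
  assumes "category A" "is_functor A B F"
  shows "is_functor (opposite A) (opposite B) F"
  by (rule is_functorI)
    (use assms in \<open>simp_all add: functor_Obj functor_Ident functor_Comp functor_hom\<close>)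

section \<open>Full subcategories\<close>

lemma Obj_full [simp]: "Obj (full_subcategory C S) = Obj C \<inter> S"
  by (simp add: full_subcategory_def Let_def)

lemma Arr_full: "Arr (full_subcategory C S) = {f \<in> Arr C. Dom C f \<in> S \<and> Cod C f \<in> S}"
  by (simp add: full_subcategory_def Let_def)

lemma hom_full: 
  "hom_set (full_subcategory C S) x y = (if x \<in> S \<and> y \<in> S then hom_set C x y else {})"
  by (auto simp: hom_set_def full_subcategory_def Let_def)

lemma Ident_full: "x \<in> Obj C \<Longrightarrow> x \<in> S \<Longrightarrow> Ident (full_subcategory C S) x = Ident C x"
  by (simp add: full_subcategory_def Let_def)

lemma Comp_full:
  "f \<in> hom_set C x y \<Longrightarrow> g \<in> hom_set C y z \<Longrightarrow> x \<in> S \<Longrightarrow> y \<in> S \<Longrightarrow> z \<in> S \<Longrightarrow>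
    Comp (full_subcategory C S) g f = Comp C g f"
  by (auto simp: full_subcategory_def Let_def hom_set_def)

lemma category_full:
  assumes "category C"
  shows "category (full_subcategory C S)"
proof -
  interpret category C by fact
  let ?D = "full_subcategory C S"
  show ?thesis
  proof
    show "Dom ?D \<in> Arr ?D \<rightarrow>\<^sub>E Obj ?D" "Cod ?D \<in> Arr ?D \<rightarrow>\<^sub>E Obj ?D"
      using Dom_PiE Cod_PiE by (auto simp: full_subcategory_def Let_def)
    show "Ident ?D \<in> extensional (Obj ?D)"
      by (simp add: full_subcategory_def Let_def)
    fix g f assume "\<not> composable ?D g f"
    then show "Comp ?D g f = undefined"
      using Comp_ext[of g f] by (auto simp: full_subcategory_def Let_def composable_def)
  next
    fix w x y z f g h
    assume *: "f \<in> hom_set ?D w x" "g \<in> hom_set ?D x y"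
    then have **: "f \<in> hom_set C w x" "g \<in> hom_set C x y" "w \<in> S" "x \<in> S" "y \<in> S"
      by (auto simp: hom_full split: if_splits)
    then show "Comp ?D g f \<in> hom_set ?D w y"
      by (simp add: Comp_full[of f C w x g y S] hom_full Comp_hom[of f w x g y])
    assume "h \<in> hom_set ?D y z"
    then have "h \<in> hom_set C y z" "z \<in> S"
      by (auto simp: hom_full split: if_splits)
    with ** show "Comp ?D h (Comp ?D g f) = Comp ?D (Comp ?D h g) f"
      by (simp add: Comp_full[of f C w x g y S] Comp_full[of g C x y h z S]
          Comp_hom[of f w x g y] Comp_hom[of g x y h z] Comp_assoc[of f w x g y h z]
          Comp_full[of "Comp C g f" C w y h z S] Comp_full[of f C w x "Comp C h g" z S])
  next
    fix x y f assume "f \<in> hom_set ?D x y"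
    then have f: "f \<in> hom_set C x y" "x \<in> S" "y \<in> S"
      by (auto simp: hom_full split: if_splits)
    note xy = hom_Obj(1,2)[OF f(1)]
    show "Comp ?D (Ident ?D y) f = f" "Comp ?D f (Ident ?D x) = f"
      using f xy Comp_full[OF f(1) Ident_hom[OF xy(2)]] Comp_full[OF Ident_hom[OF xy(1)] f(1)]
      by (simp_all add: Ident_full Comp_Ident_left Comp_Ident_right)
  qed (auto simp: hom_full Ident_full Ident_hom)
qed

lemma finite_acyclic_category_full:
  assumes "finite_acyclic_category C"
  shows "finite_acyclic_category (full_subcategory C S)"
proof -
  interpret finite_acyclic_category C by fact
  interpret D: category "full_subcategory C S" using category_axioms by (rule category_full)
  show ?thesis
    by unfold_locales
      (use hom_antisym endo_Ident finite_Obj finite_Arr in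
        \<open>auto simp: hom_full Ident_full Arr_full split: if_splits\<close>)
qed

lemma full_opposite: "full_subcategory (opposite C) S = opposite (full_subcategory C S)"
  by (auto simp: full_subcategory_def opposite_def Let_def conj_commute intro!: arg_cong2[where f=restrict] ext)

text \<open>Collapses remove objects one at a time, while the target is named by its final object
  set; this equality glues the steps together.\<close>

lemma full_full:
  assumes "category C" and TS: "T \<subseteq> S"
  shows "full_subcategory (full_subcategory C S) T = full_subcategory C T"
proof (intro category_eqI category_full assms(1) is_functorI; clarsimp?)
  let ?D = "full_subcategory C S"
  show "Obj C \<inter> S \<inter> T = Obj C \<inter> T" using TS by auto
  show "Arr (full_subcategory ?D T) = Arr (full_subcategory C T)"
    using TS by (auto simp: full_subcategory_def Let_def)
  fix x assume "x \<in> Obj C" "x \<in> S" "x \<in> T"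
  then show "Ident (full_subcategory ?D T) x = Ident (full_subcategory C T) x"
    by (simp add: Ident_full)
next
  fix x y f assume "f \<in> hom_set (full_subcategory (full_subcategory C S) T) x y"
  then show "f \<in> hom_set (full_subcategory C T) x y"
    using TS by (auto simp: hom_full split: if_splits)
next
  fix x y z f g
  assume "f \<in> hom_set (full_subcategory (full_subcategory C S) T) x y"
    "g \<in> hom_set (full_subcategory (full_subcategory C S) T) y z"
  then have "f \<in> hom_set C x y" "g \<in> hom_set C y z" "x \<in> T" "y \<in> T" "z \<in> T"
    "x \<in> S" "y \<in> S" "z \<in> S"
    using TS by (auto simp: hom_full split: if_splits)
  then show "Comp (full_subcategory (full_subcategory C S) T) g f = Comp (full_subcategory C T) g f"
    by (simp add: Comp_full[of f _ x y g z] hom_full)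
qed

lemma is_functor_full_inclusion:
  "is_functor (full_subcategory C S) C id_functor"
  by (rule is_functorI) (auto simp: hom_full Ident_full Comp_full split: if_splits)

lemma is_functor_into_full:
  assumes "category A" "is_functor A C F" "\<And>x. x \<in> Obj A \<Longrightarrow> omap F x \<in> S"
  shows "is_functor A (full_subcategory C S) F"
proof (rule is_functorI)
  interpret category A by fact
  fix x y f assume f: "f \<in> hom_set A x y"
  then have x: "omap F x \<in> S" and y: "omap F y \<in> S"
    using assms(3) hom_Obj by auto
  then show "amap F f \<in> hom_set (full_subcategory C S) (omap F x) (omap F y)"
    using functor_hom[OF assms(1,2) f] by (simp add: hom_full)
  fix z g assume g: "g \<in> hom_set A y z"
  then have "omap F z \<in> S"
    using assms(3) hom_Obj by auto
  then show "amap F (Comp A g f) = Comp (full_subcategory C S) (amap F g) (amap F f)"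
    using functor_Comp[OF assms(2) f g] x y
      Comp_full[OF functor_hom[OF assms(1,2) f] functor_hom[OF assms(1,2) g]] by simp
qed (use assms in \<open>auto simp: functor_Obj functor_Ident Ident_full\<close>)

subsection \<open>Homotopy and coreflective subcategories\<close>

text \<open>Hiding the components leaves a plain relation on functors, to which
  \<open>symclp\<close> and \<open>equivclp\<close> apply.\<close>

definition natural_map :: "('o, 'm) category \<Rightarrow> ('p, 'n) category \<Rightarrow>
    ('o, 'm, 'p, 'n) functor_maps \<Rightarrow> ('o, 'm, 'p, 'n) functor_maps \<Rightarrow> bool" where
  "natural_map A B F G \<longleftrightarrow> (\<exists>\<eta>. natural_transformation A B F G \<eta>)"

lemma natural_mapI:
  assumes "is_functor A B F" "is_functor A B G"
    and "\<And>x. x \<in> Obj A \<Longrightarrow> \<eta> x \<in> hom_set B (omap F x) (omap G x)"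
    and "\<And>x y f. f \<in> hom_set A x y \<Longrightarrow> Comp B (\<eta> y) (amap F f) = Comp B (amap G f) (\<eta> x)"
  shows "natural_map A B F G"
  using assms unfolding natural_map_def natural_transformation_def by blast

lemma natural_transformationD:
  assumes "category A" "natural_transformation A B F G \<eta>"
  shows "is_functor A B F" "is_functor A B G"
    and "x \<in> Obj A \<Longrightarrow> \<eta> x \<in> hom_set B (omap F x) (omap G x)"
    and "f \<in> hom_set A x y \<Longrightarrow> Comp B (\<eta> y) (amap F f) = Comp B (amap G f) (\<eta> x)"
  using assms category.hom_Obj(1,2)[OF assms(1)] by (auto simp: natural_transformation_def)

lemma natural_map_agree:
  assumes "category A" "category B" "is_functor A B F" "is_functor A B G"
    and "\<And>x. x \<in> Obj A \<Longrightarrow> omap F x = omap G x"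
    and "\<And>f. f \<in> Arr A \<Longrightarrow> amap F f = amap G f"
  shows "natural_map A B F G"
proof (rule natural_mapI)
  interpret A: category A by fact
  interpret B: category B by fact
  fix x assume "x \<in> Obj A"
  then show "Ident B (omap F x) \<in> hom_set B (omap F x) (omap G x)"
    using assms(3,5) functor_Obj B.Ident_hom by fastforce
next
  interpret A: category A by fact
  interpret B: category B by fact
  fix x y f assume f: "f \<in> hom_set A x y"
  show "Comp B (Ident B (omap F y)) (amap F f) = Comp B (amap G f) (Ident B (omap F x))"
    using B.Comp_Ident_left B.Comp_Ident_right functor_hom[OF assms(1,3) f] assms(6) A.hom_Obj[OF f]
    by metis
qed fact+

lemma natural_map_cong:
  assumes "category A" "natural_map A B F G"
    and F: "\<And>x. x \<in> Obj A \<Longrightarrow> omap F' x = omap F x" "\<And>f. f \<in> Arr A \<Longrightarrow> amap F' f = amap F f"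
    and G: "\<And>x. x \<in> Obj A \<Longrightarrow> omap G' x = omap G x" "\<And>f. f \<in> Arr A \<Longrightarrow> amap G' f = amap G f"
  shows "natural_map A B F' G'"
proof -
  interpret category A by fact
  obtain \<eta> where "natural_transformation A B F G \<eta>"
    using assms(2) natural_map_def by blast
  note \<eta> = natural_transformationD[OF assms(1) this]
  show ?thesis
  proof (rule natural_mapI)
    show "is_functor A B F'" "is_functor A B G'"
      using is_functor_cong[OF assms(1) \<eta>(1) F] is_functor_cong[OF assms(1) \<eta>(2) G] by blast+
    fix x y f assume f: "f \<in> hom_set A x y"
    show "Comp B (\<eta> y) (amap F' f) = Comp B (amap G' f) (\<eta> x)"
      using \<eta>(4)[OF f] F(2) G(2) hom_Obj(3)[OF f] by simp
  qed (use \<eta>(3) F G in simp)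
qed

lemma natural_map_comp_left:
  assumes "category A" "category B" "natural_map A B F G" "is_functor B C K"
  shows "natural_map A C (comp_functor K F) (comp_functor K G)"
proof -
  interpret category A by fact
  obtain \<eta> where "natural_transformation A B F G \<eta>"
    using assms(3) natural_map_def by blast
  note \<eta> = natural_transformationD[OF assms(1) this]
  show ?thesis
  proof (rule natural_mapI)
    fix x assume "x \<in> Obj A"
    then show "amap K (\<eta> x) \<in> hom_set C (omap (comp_functor K F) x) (omap (comp_functor K G) x)"
      using functor_hom[OF assms(2,4) \<eta>(3)] by simp
  next
    fix x y f assume f: "f \<in> hom_set A x y"
    note xy = hom_Obj(1,2)[OF f]
    show "Comp C (amap K (\<eta> y)) (amap (comp_functor K F) f) =
        Comp C (amap (comp_functor K G) f) (amap K (\<eta> x))"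
      using functor_Comp[OF assms(4) functor_hom[OF assms(1) \<eta>(1) f] \<eta>(3)[OF xy(2)]]
        functor_Comp[OF assms(4) \<eta>(3)[OF xy(1)] functor_hom[OF assms(1) \<eta>(2) f]] \<eta>(4)[OF f]
      by simp
  qed (use is_functor_comp assms \<eta> in blast)+
qed

lemma natural_map_comp_right:
  assumes "category A" "category B" "natural_map B C F G" "is_functor A B K"
  shows "natural_map A C (comp_functor F K) (comp_functor G K)"
proof -
  obtain \<eta> where "natural_transformation B C F G \<eta>"
    using assms(3) natural_map_def by blast
  note \<eta> = natural_transformationD[OF assms(2) this]
  show ?thesis
    by (rule natural_mapI[where \<eta> = "\<lambda>x. \<eta> (omap K x)"])
      (use assms \<eta> functor_Obj[OF assms(4)] \<eta>(4)[OF functor_hom[OF assms(1,4)]] in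
        \<open>simp_all add: is_functor_comp[of A B]\<close>)
qed

lemma natural_map_opposite:
  assumes "category A" "natural_map A B F G"
  shows "natural_map (opposite A) (opposite B) G F"
proof -
  obtain \<eta> where "natural_transformation A B F G \<eta>"
    using assms(2) natural_map_def by blast
  note \<eta> = natural_transformationD[OF assms(1) this]
  show ?thesis
    by (rule natural_mapI[where \<eta> = \<eta>]) (use assms(1) \<eta> in \<open>simp_all add: is_functor_opposite\<close>)
qed

section \<open>Homotopy as an equivalence closure\<close>

lemma homotopic_refl: "is_functor A B F \<Longrightarrow> homotopic A B F F"
  unfolding homotopic_def by (intro exI[of _ 0] exI[of _ "\<lambda>_. F"]) simp

text \<open>In \<open>homotopic\<close> the parity of the position dictates the direction of each
  arrow. If the new arrow points the wrong way at position \<open>n\<close>, an identity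
  transformation on \<open>G\<close> is inserted first, which shifts the parity by one.\<close>

lemma homotopic_step:
  assumes "category A" "category B" "homotopic A B F G" and GK: "symclp (natural_map A B) G K"
  shows "homotopic A B F K"
proof -
  let ?ok = "\<lambda>i X Y. if even i then natural_map A B X Y else natural_map A B Y X"
  have homotopicI: "homotopic A B F L"
    if "H 0 = F" "H n = L" "\<forall>i\<le>n. is_functor A B (H i)" "\<forall>i<n. ?ok i (H i) (H (Suc i))"
    for H L and n :: nat
    using that unfolding homotopic_def natural_map_def by blast
  have GK_fun: "is_functor A B G" "is_functor A B K"
    using GK by (auto simp: symclp_def natural_map_def natural_transformation_def)
  have extend: "\<exists>H. H 0 = F \<and> H (Suc n) = L \<and> (\<forall>i\<le>Suc n. is_functor A B (H i)) \<and>
      (\<forall>i<Suc n. ?ok i (H i) (H (Suc i)))"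
    if H: "H 0 = F" "\<forall>i\<le>n. is_functor A B (H i)" "\<forall>i<n. ?ok i (H i) (H (Suc i))"
      and L: "is_functor A B L" "?ok n (H n) L" for H L and n :: nat
    using that by (intro exI[of _ "H(Suc n := L)"]) (auto simp: less_Suc_eq le_Suc_eq)
  obtain n H where H: "H 0 = F" "H n = G" "\<forall>i\<le>n. is_functor A B (H i)"
    "\<forall>i<n. ?ok i (H i) (H (Suc i))"
    using assms(3) unfolding homotopic_def natural_map_def by blast
  show ?thesis
  proof (cases "?ok n G K")
    case True
    then obtain H' where "H' 0 = F" "H' (Suc n) = K" "\<forall>i\<le>Suc n. is_functor A B (H' i)"
      "\<forall>i<Suc n. ?ok i (H' i) (H' (Suc i))"
      using extend[OF H(1,3,4), of K] H(2) GK_fun by blast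
    then show ?thesis by (rule homotopicI)
  next
    case False
    have "natural_map A B G G"
      using natural_map_agree[OF assms(1,2) GK_fun(1) GK_fun(1)] by simp
    then have "?ok n (H n) G" using H(2) by simp
    then obtain H' where H': "H' 0 = F" "H' (Suc n) = G" "\<forall>i\<le>Suc n. is_functor A B (H' i)"
      "\<forall>i<Suc n. ?ok i (H' i) (H' (Suc i))"
      using extend[OF H(1,3,4), of G] GK_fun by blast
    have "?ok (Suc n) (H' (Suc n)) K"
      using False GK H'(2) by (auto simp: symclp_def split: if_splits)
    then obtain H'' where "H'' 0 = F" "H'' (Suc (Suc n)) = K"
      "\<forall>i\<le>Suc (Suc n). is_functor A B (H'' i)"
      "\<forall>i<Suc (Suc n). ?ok i (H'' i) (H'' (Suc i))"
      using extend[OF H'(1,3,4), of K] GK_fun by blast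
    then show ?thesis by (rule homotopicI)
  qed
qed

lemma homotopic_iff_equivclp:
  assumes "category A" "category B" "is_functor A B F"
  shows "homotopic A B F G \<longleftrightarrow> equivclp (natural_map A B) F G"
proof
  assume "homotopic A B F G"
  then obtain n :: nat and H where H: "H 0 = F" "H n = G"
    "\<forall>i<n. symclp (natural_map A B) (H i) (H (Suc i))"
    unfolding homotopic_def natural_map_def symclp_def by metis
  then show "equivclp (natural_map A B) F G"
    unfolding equivclp_def rtranclp_power relpowp_fun_conv by blast
next
  assume "equivclp (natural_map A B) F G"
  then have "(symclp (natural_map A B))\<^sup>*\<^sup>* F G" by (simp add: equivclp_def)
  then show "homotopic A B F G"
  proof induction
    case base
    then show ?case using assms(3) by (rule homotopic_refl)
  next
    case (step G K)
    then show ?case using homotopic_step[OF assms(1,2)] by blast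
  qed
qed

lemma equivclp_image:
  assumes "equivclp R x y" and "\<And>x y. R x y \<Longrightarrow> R' (f x) (f y)"
  shows "equivclp R' (f x) (f y)"
  using assms(1)
proof (induction rule: equivclp_induct)
  case (step y z)
  then show ?case using assms(2) by (meson equivclp_into_equivclp symclpI)
qed simp

section \<open>Strong homotopy equivalence is an equivalence relation compatible with
  opposites\<close>

lemma strongly_homotopy_equivalent_iff:
  assumes "category A" "category B"
  shows "strongly_homotopy_equivalent A B \<longleftrightarrow>
    (\<exists>F G. is_functor A B F \<and> is_functor B A G \<and>
      equivclp (natural_map A A) (comp_functor G F) id_functor \<and>
      equivclp (natural_map B B) (comp_functor F G) id_functor)"
  unfolding strongly_homotopy_equivalent_def
  by (intro ex_cong1 conj_cong refl homotopic_iff_equivclp assms)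
    (use is_functor_comp assms in blast)+

lemma strongly_homotopy_equivalent_refl: "strongly_homotopy_equivalent A A"
  unfolding strongly_homotopy_equivalent_def
  by (intro exI[of _ id_functor]) (simp add: homotopic_refl)

lemma strongly_homotopy_equivalent_sym:
  "strongly_homotopy_equivalent A B \<Longrightarrow> strongly_homotopy_equivalent B A"
  unfolding strongly_homotopy_equivalent_def by blast

text \<open>This is the core of transitivity. In the composite round trip through three categories,
  the inner round trip plays the role of \<open>K\<close>; whiskering contracts it to the identity
  and leaves \<open>G\<close> after \<open>F\<close>.\<close>

lemma equivclp_natural_map_conjugate:
  assumes "category A" "category B" "is_functor A B F" "is_functor B A G"
    and GF: "equivclp (natural_map A A) (comp_functor G F) id_functor"
    and K: "equivclp (natural_map B B) K id_functor"
  shows "equivclp (natural_map A A) (comp_functor (comp_functor G K) F) id_functor"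
proof -
  have "equivclp (natural_map A A) (comp_functor (comp_functor G K) F)
      (comp_functor (comp_functor G id_functor) F)"
    by (rule equivclp_image[OF K, of "natural_map A A" "\<lambda>K. comp_functor (comp_functor G K) F"])
      (use assms in \<open>blast intro: natural_map_comp_left natural_map_comp_right\<close>)
  then show ?thesis using equivclp_trans GF by fastforce
qed

lemma strongly_homotopy_equivalent_trans:
  assumes "category A" "category B" "category C"
    and "strongly_homotopy_equivalent A B" "strongly_homotopy_equivalent B C"
  shows "strongly_homotopy_equivalent A C"
proof -
  obtain F G where FG: "is_functor A B F" "is_functor B A G"
    "equivclp (natural_map A A) (comp_functor G F) id_functor"
    "equivclp (natural_map B B) (comp_functor F G) id_functor"
    using assms(4) unfolding strongly_homotopy_equivalent_iff[OF assms(1,2)] by blast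
  obtain F' G' where FG': "is_functor B C F'" "is_functor C B G'"
    "equivclp (natural_map B B) (comp_functor G' F') id_functor"
    "equivclp (natural_map C C) (comp_functor F' G') id_functor"
    using assms(5) unfolding strongly_homotopy_equivalent_iff[OF assms(2,3)] by blast
  have "equivclp (natural_map A A) (comp_functor (comp_functor G G') (comp_functor F' F)) id_functor"
    using equivclp_natural_map_conjugate[OF assms(1,2) FG(1-3) FG'(3)]
    by (simp add: comp_functor_assoc)
  moreover have
    "equivclp (natural_map C C) (comp_functor (comp_functor F' F) (comp_functor G G')) id_functor"
    using equivclp_natural_map_conjugate[OF assms(3,2) FG'(2,1,4) FG(4)]
    by (simp add: comp_functor_assoc)
  ultimately show ?thesis
    unfolding strongly_homotopy_equivalent_iff[OF assms(1,3)]
    using is_functor_comp[OF assms(1,2) FG(1) FG'(1)] is_functor_comp[OF assms(3,2) FG'(2) FG(2)]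
    by blast
qed

lemma strongly_homotopy_equivalent_opposite:
  assumes "category A" "category B" "strongly_homotopy_equivalent A B"
  shows "strongly_homotopy_equivalent (opposite A) (opposite B)"
proof -
  \<comment> \<open>Passing to opposites reverses natural transformations, so natural maps land in
    the converse relation; an equivalence closure does not distinguish a relation from its
    converse.\<close>
  have op: "equivclp (natural_map (opposite C) (opposite C)) F G"
    if "category C" "equivclp (natural_map C C) F G" for C :: "('x, 'y) category" and F G
    using equivclp_image[where f = "\<lambda>F. F" and R' = "(natural_map (opposite C) (opposite C))\<inverse>\<inverse>",
        OF that(2)] natural_map_opposite[OF that(1), of C] by simp
  show ?thesis
    using assms(3)
    unfolding strongly_homotopy_equivalent_iff[OF assms(1,2)]
      strongly_homotopy_equivalent_iff[OF assms(1,2)[THEN category_opposite]]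
    using is_functor_opposite op assms(1,2) by metis
qed

section \<open>Coreflective full subcategories\<close>

definition universal_arrow :: "('o, 'm) category \<Rightarrow> 'o set \<Rightarrow> 'o \<Rightarrow> 'o \<Rightarrow> 'm \<Rightarrow> bool" where
  "universal_arrow C S x s e \<longleftrightarrow> s \<in> S \<and> e \<in> hom_set C s x \<and>
    (\<forall>z\<in>S. \<forall>g\<in>hom_set C z x. \<exists>!h. h \<in> hom_set C z s \<and> g = Comp C e h)"

lemma universal_arrowD:
  assumes "universal_arrow C S x s e"
  shows "s \<in> S" "e \<in> hom_set C s x"
    and "z \<in> S \<Longrightarrow> g \<in> hom_set C z x \<Longrightarrow> \<exists>!h. h \<in> hom_set C z s \<and> g = Comp C e h"
  using assms by (simp_all add: universal_arrow_def)

text \<open>This is the pointwise form of a right adjoint to the inclusion of the full subcategory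
  on \<open>S\<close>; the arrows \<open>e\<close> are the components of the counit.\<close>

definition coreflective :: "('o, 'm) category \<Rightarrow> 'o set \<Rightarrow> bool" where
  "coreflective C S \<longleftrightarrow> S \<subseteq> Obj C \<and> (\<forall>x\<in>Obj C. \<exists>s e. universal_arrow C S x s e)"

text \<open>The coreflector \<open>r\<close> sends \<open>g\<close> from \<open>x\<close> to
  \<open>y\<close> to the unique factor of \<open>g\<close> after \<open>e x\<close> through
  \<open>e y\<close>. The defining square of this factor is the naturality of \<open>e\<close>, and
  uniqueness of factors gives functoriality.\<close>

lemma coreflective_strongly_homotopy_equivalent:
  assumes "category C" "coreflective C S"
  shows "strongly_homotopy_equivalent C (full_subcategory C S)"
proof -
  interpret category C by fact
  let ?D = "full_subcategory C S"
  have D: "category ?D" using assms(1) by (rule category_full)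
  have S: "S \<subseteq> Obj C" using assms(2) by (simp add: coreflective_def)
  obtain s e where "\<And>x. x \<in> Obj C \<Longrightarrow> universal_arrow C S x (s x) (e x)"
    using assms(2) unfolding coreflective_def by metis
  note univ = universal_arrowD[OF this]
  note s = univ(1) and e = univ(2) and u = univ(3)
  \<comment> \<open>The endpoints are read off from \<open>g\<close> itself, since
    \<open>amap\<close> receives only the arrow. The relation is named so that \<open>THE\<close>
    can select the factor.\<close>
  define p where "p g h \<longleftrightarrow> h \<in> hom_set C (s (Dom C g)) (s (Cod C g)) \<and>
    Comp C g (e (Dom C g)) = Comp C (e (Cod C g)) h" for g h
  define r where "r = \<lparr>omap = s, amap = \<lambda>g. THE h. p g h\<rparr>"
  have p: "\<exists>!h. p g h" if "g \<in> hom_set C x y" for g x y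
  proof -
    note g = hom_Obj[OF that]
    show ?thesis
      using u[OF g(2) s[OF g(1)] Comp_hom[OF e[OF g(1)] that]] by (simp add: p_def g)
  qed
  have r: "p g (amap r g)" if "g \<in> hom_set C x y" for g x y
    using theI'[OF p[OF that]] by (simp add: r_def)
  have r_eq: "amap r g = h" if "g \<in> hom_set C x y" "h \<in> hom_set C (s x) (s y)"
    "Comp C g (e x) = Comp C (e y) h" for g h x y
    using the1_equality[OF p[OF that(1)], of h] that hom_Obj[OF that(1)] by (simp add: r_def p_def)
  have r_hom: "amap r g \<in> hom_set C (s x) (s y)"
    and r_comm: "Comp C (e y) (amap r g) = Comp C g (e x)"
    if "g \<in> hom_set C x y" for g x y
    using r[OF that] hom_Obj[OF that] by (simp_all add: p_def)
  have r_fun: "is_functor C C r"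
  proof (rule is_functorI)
    fix x assume x: "x \<in> Obj C"
    then show "omap r x \<in> Obj C" using s S by (auto simp: r_def)
    then show "amap r (Ident C x) = Ident C (omap r x)"
      using r_eq[OF Ident_hom[OF x] Ident_hom] Comp_Ident_left[OF e[OF x]]
        Comp_Ident_right[OF e[OF x]] by (simp add: r_def)
  next
    fix x y f assume f: "f \<in> hom_set C x y"
    then show "amap r f \<in> hom_set C (omap r x) (omap r y)"
      using r_hom[OF f] by (simp add: r_def)
    fix z g assume g: "g \<in> hom_set C y z"
    have "Comp C (Comp C g f) (e x) = Comp C g (Comp C f (e x))"
      using Comp_assoc e f g hom_Obj by metis
    also have "\<dots> = Comp C g (Comp C (e y) (amap r f))"
      using r_comm[OF f] by simp
    also have "\<dots> = Comp C (Comp C g (e y)) (amap r f)"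
      using Comp_assoc[OF r_hom[OF f] e g] hom_Obj[OF f] by simp
    also have "\<dots> = Comp C (e z) (Comp C (amap r g) (amap r f))"
      using Comp_assoc[OF r_hom[OF f] r_hom[OF g] e] hom_Obj[OF g] r_comm[OF g] by simp
    finally show "amap r (Comp C g f) = Comp C (amap r g) (amap r f)"
      by (rule r_eq[OF Comp_hom[OF f g] Comp_hom[OF r_hom[OF f] r_hom[OF g]]])
  qed
  have r_into: "is_functor C ?D r"
    by (rule is_functor_into_full[OF assms(1) r_fun]) (simp add: r_def s)
  have nat: "natural_map C C r id_functor"
    by (rule natural_mapI[where \<eta> = e]) (use r_fun e r_comm in \<open>simp_all add: r_def\<close>)
  \<comment> \<open>On objects of \<open>S\<close> the chosen \<open>s x\<close> need not be
    \<open>x\<close> itself, so \<open>r\<close> restricted to \<open>?D\<close> is linked to the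
    identity by \<open>e\<close> again and not by equality. The components of \<open>e\<close> at
    such objects do lie in \<open>?D\<close>.\<close>
  have "is_functor ?D ?D r"
    using is_functor_comp[OF D assms(1) is_functor_full_inclusion r_into] by simp
  then have "natural_map ?D ?D r id_functor"
  proof (rule natural_mapI)
    fix x assume "x \<in> Obj ?D"
    then show "e x \<in> hom_set ?D (omap r x) (omap id_functor x)"
      using s e by (simp add: hom_full r_def)
  next
    fix x y f assume "f \<in> hom_set ?D x y"
    then have f: "f \<in> hom_set C x y" and xy: "x \<in> S" "y \<in> S" "x \<in> Obj C" "y \<in> Obj C"
      using S by (auto simp: hom_full split: if_splits)
    show "Comp ?D (e y) (amap r f) = Comp ?D (amap id_functor f) (e x)"
      using Comp_full[OF r_hom[OF f] e[OF xy(4)]] Comp_full[OF e[OF xy(3)] f] s xy r_comm[OF f]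
      by simp
  qed simp
  then have "equivclp (natural_map C C) r id_functor" "equivclp (natural_map ?D ?D) r id_functor"
    using nat by (auto intro: r_into_equivclp)
  then show ?thesis
    unfolding strongly_homotopy_equivalent_iff[OF assms(1) D]
    using r_into is_functor_full_inclusion
    by - (rule exI[of _ r], rule exI[of _ id_functor], simp)
qed

lemma (in category) not_identity:
  "f \<in> hom_set C x y \<Longrightarrow> x \<noteq> y \<Longrightarrow> \<not> is_identity C f"
  using Ident_hom by (auto simp: is_identity_def hom_set_def)

lemma (in acyclic_category) non_identity_neq:
  "f \<in> hom_set C x y \<Longrightarrow> \<not> is_identity C f \<Longrightarrow> x \<noteq> y"
  using endo_Ident hom_Obj(1) unfolding is_identity_def by metis

text \<open>The beat arrow is universal at \<open>x\<close>, and every other object is its own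
  coreflection. Acyclicity ensures that the source of the beat arrow differs from \<open>x\<close>,
  and hence survives the removal.\<close>

lemma down_beat_coreflective:
  assumes "acyclic_category C" "down_beat_object C x"
  shows "coreflective C (Obj C - {x})"
  unfolding coreflective_def
proof (intro conjI ballI)
  interpret acyclic_category C by fact
  obtain y f where f: "f \<in> hom_set C y x" "\<not> is_identity C f"
    and u: "\<And>z g. z \<in> Obj C \<Longrightarrow> g \<in> hom_set C z x \<Longrightarrow> \<not> is_identity C g \<Longrightarrow>
      \<exists>!h. h \<in> hom_set C z y \<and> g = Comp C f h"
    using assms(2) unfolding down_beat_object_def by blast
  fix w assume w: "w \<in> Obj C"
  show "\<exists>s e. universal_arrow C (Obj C - {x}) w s e"
  proof (cases "w = x")
    case True
    have "y \<in> Obj C - {x}" using hom_Obj[OF f(1)] non_identity_neq[OF f] by simp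
    moreover have "\<exists>!h. h \<in> hom_set C z y \<and> g = Comp C f h"
      if "z \<in> Obj C - {x}" "g \<in> hom_set C z x" for z g
      using u[of z g] that not_identity[OF that(2)] by simp
    ultimately have "universal_arrow C (Obj C - {x}) x y f"
      using f(1) by (simp add: universal_arrow_def)
    then show ?thesis using True by blast
  next
    case False
    have "\<exists>!h. h \<in> hom_set C z w \<and> g = Comp C (Ident C w) h" if "g \<in> hom_set C z w" for z g
      using that Comp_Ident_left by metis
    then have "universal_arrow C (Obj C - {x}) w w (Ident C w)"
      using False w Ident_hom by (simp add: universal_arrow_def)
    then show ?thesis by blast
  qed
qed simp

text \<open>In an acyclic category, having an arrow between distinct objects is a strict partial
  order, so finite nonempty sets of objects have minimal elements.\<close>

lemma (in finite_acyclic_category) ex_minimal: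
  assumes "T \<subseteq> Obj C" "T \<noteq> {}"
  obtains x where "x \<in> T" "\<And>z. z \<in> T \<Longrightarrow> hom_set C z x \<noteq> {} \<Longrightarrow> z = x"
proof -
  define R where "R z x \<longleftrightarrow> z \<noteq> x \<and> hom_set C z x \<noteq> {}" for z x
  have "asymp_on T R"
    using hom_antisym assms(1) by (auto simp: asymp_on_def R_def)
  moreover have "transp_on T R"
  proof (rule transp_onI)
    fix x y z assume "x \<in> T" "y \<in> T" "z \<in> T" "R x y" "R y z"
    then show "R x z"
      using hom_antisym[of x y] assms(1) Comp_hom[of _ x y _ z] unfolding R_def by blast
  qed
  ultimately obtain x where "x \<in> T" "\<forall>z\<in>T. z \<noteq> x \<longrightarrow> \<not> R z x"
    using Finite_Set.bex_min_element[of T R] assms finite_Obj finite_subset by blast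
  then show ?thesis using that unfolding R_def by blast
qed

lemma full_Obj: "category C \<Longrightarrow> full_subcategory C (Obj C) = C"
  using category.hom_Obj(1,2)[OF _ category.Arr_hom]
  by (intro category_eqI) (auto simp: category_full is_functor_full_inclusion Arr_full)

text \<open>A universal arrow is tested only against arrows from \<open>S\<close>, a beat arrow
  against all non-identity arrows. At an object \<open>x\<close> minimal outside \<open>S\<close>
  the two tests coincide: every non-identity arrow into \<open>x\<close> starts in \<open>S\<close>.
  So \<open>x\<close> can be removed, and \<open>S\<close> remains coreflective in the rest.\<close>

lemma coreflective_strong_collapse:
  assumes "finite_acyclic_category C" "coreflective C S"
  shows "strong_collapse C (full_subcategory C S)"
  using assms
proof (induction "card (Obj C - S)" arbitrary: C rule: less_induct)
  case less
  interpret finite_acyclic_category C by fact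
  have S: "S \<subseteq> Obj C" using less.prems(2) by (simp add: coreflective_def)
  show ?case
  proof (cases "Obj C - S = {}")
    case True
    then have "full_subcategory C S = C" using S full_Obj[OF category_axioms] by auto
    then show ?thesis by (simp add: strong_collapse_def)
  next
    case False
    then obtain x where x: "x \<in> Obj C - S"
      and min: "\<And>z. z \<in> Obj C - S \<Longrightarrow> hom_set C z x \<noteq> {} \<Longrightarrow> z = x"
      using ex_minimal[of "Obj C - S"] by blast
    let ?D = "full_subcategory C (Obj C - {x})"
    have u: "\<exists>s e. universal_arrow C S w s e" if "w \<in> Obj C" for w
      using less.prems(2) that by (simp add: coreflective_def)
    obtain s e where "universal_arrow C S x s e"
      using u[of x] x by blast
    note univ = universal_arrowD[OF this]
    have "s \<noteq> x" using univ(1) x by blast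
    then have e: "\<not> is_identity C e" by (rule not_identity[OF univ(2)])
    have "z \<in> S" if "g \<in> hom_set C z x" "\<not> is_identity C g" for z g
      using min[of z] non_identity_neq[OF that] that(1) hom_Obj[OF that(1)] by blast
    then have "\<exists>!h. h \<in> hom_set C z s \<and> g = Comp C e h"
      if "g \<in> hom_set C z x" "\<not> is_identity C g" for z g
      using univ(3) that by simp
    then have "down_beat_object C x"
      unfolding down_beat_object_def using x S univ(1,2) e
      by (intro conjI bexI[of _ s] bexI[of _ e]) auto
    then have el: "elementary_strong_collapse C ?D"
      unfolding elementary_strong_collapse_def beat_object_def by blast
    have SD: "S \<subseteq> Obj C - {x}" using S x by blast
    \<comment> \<open>For \<open>w\<close> other than \<open>x\<close>, the factorisations to be
      checked involve only arrows between \<open>w\<close> and objects of \<open>S\<close>. None of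
      them touches \<open>x\<close>, so the old universal arrows still work.\<close>
    have "coreflective ?D S"
      unfolding coreflective_def
    proof (intro conjI ballI)
      fix w assume "w \<in> Obj ?D"
      then have w: "w \<in> Obj C" "w \<in> Obj C - {x}" by auto
      obtain s e where "universal_arrow C S w s e"
        using u[OF w(1)] by blast
      note univ = universal_arrowD[OF this]
      have homD: "hom_set ?D z v = hom_set C z v" if "z \<in> S" "v \<in> Obj C - {x}" for z v
        using that SD by (auto simp: hom_full)
      have sD: "s \<in> Obj C - {x}" using univ(1) SD by blast
      have compD: "Comp ?D e h = Comp C e h" if "z \<in> S" "h \<in> hom_set C z s" for z h
        using Comp_full[OF that(2) univ(2)] that(1) sD SD w by blast
      have "\<exists>!h. h \<in> hom_set ?D z s \<and> g = Comp ?D e h"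
        if "z \<in> S" "g \<in> hom_set ?D z w" for z g
        using univ(3)[of z g] that homD[OF that(1)] w sD compD[OF that(1)]
        by (simp cong: conj_cong)
      then have "universal_arrow ?D S w s e"
        using univ(1,2) homD[OF univ(1) w(2)] by (simp add: universal_arrow_def)
      then show "\<exists>s e. universal_arrow ?D S w s e" by blast
    qed (use SD in auto)
    moreover have "card (Obj ?D - S) < card (Obj C - S)"
      using x finite_Obj by (intro psubset_card_mono) auto
    ultimately have "strong_collapse ?D (full_subcategory ?D S)"
      using less.hyps finite_acyclic_category_full[OF less.prems(1)] by blast
    then show ?thesis
      using el full_full[OF category_axioms SD] unfolding strong_collapse_def
      by (simp add: converse_rtranclp_into_rtranclp)
  qed
qed

subsection \<open>Beat objects and strong collapses\<close>

text \<open>At a minimal moved object \<open>x\<close>, the factor of \<open>g\<close> through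
  \<open>\<eta> x\<close> is \<open>amap F g\<close>. The source \<open>z\<close> of a non-identity
  \<open>g\<close> is fixed by minimality, so \<open>\<eta> z\<close> is an identity and the
  naturality square of \<open>g\<close> reads as the required factorisation. On arrows, naturality
  between fixed objects is the equation \<open>amap F f = f\<close>.\<close>

lemma natural_map_to_id_rigid:
  assumes "finite_acyclic_category C" and no_beat: "\<And>x. \<not> down_beat_object C x"
    and "natural_map C C F id_functor"
  shows "x \<in> Obj C \<Longrightarrow> omap F x = x" and "f \<in> Arr C \<Longrightarrow> amap F f = f"
proof -
  interpret finite_acyclic_category C by fact
  obtain \<eta> where "natural_transformation C C F id_functor \<eta>"
    using assms(3) natural_map_def by blast
  note nt = natural_transformationD[OF category_axioms this]
  note F = nt(1)
  have \<eta>: "\<eta> x \<in> hom_set C (omap F x) x" if "x \<in> Obj C" for x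
    using nt(3)[OF that] by simp
  have nat: "Comp C (\<eta> y) (amap F f) = Comp C f (\<eta> x)" if "f \<in> hom_set C x y" for f x y
    using nt(4)[OF that] by simp
  note F_hom = functor_hom[OF category_axioms F]
  have \<eta>_Ident: "\<eta> x = Ident C x" if "x \<in> Obj C" "omap F x = x" for x
    using \<eta>[OF that(1)] that endo_Ident by simp
  have fixed: "amap F f = f"
    if f: "f \<in> hom_set C x y" and eq: "omap F x = x" "omap F y = y" for f x y
  proof -
    note xy = hom_Obj(1,2)[OF f]
    have "amap F f \<in> hom_set C x y" using F_hom[OF f] eq by simp
    then have "amap F f = Comp C (\<eta> y) (amap F f)"
      using \<eta>_Ident[OF xy(2) eq(2)] Comp_Ident_left by simp
    also have "\<dots> = f"
      using nat[OF f] \<eta>_Ident[OF xy(1) eq(1)] Comp_Ident_right[OF f] by simp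
    finally show ?thesis .
  qed
  have obj: "omap F x = x" if x0: "x \<in> Obj C" for x
  proof (rule ccontr)
    assume "omap F x \<noteq> x"
    then have "{x \<in> Obj C. omap F x \<noteq> x} \<noteq> {}" using x0 by blast
    then obtain x where xT: "x \<in> {x \<in> Obj C. omap F x \<noteq> x}"
      and min: "\<And>z. z \<in> {x \<in> Obj C. omap F x \<noteq> x} \<Longrightarrow> hom_set C z x \<noteq> {} \<Longrightarrow> z = x"
      by (rule ex_minimal[rotated]) auto
    then have x: "x \<in> Obj C" "omap F x \<noteq> x" by simp_all
    let ?y = "omap F x"
    have below: "omap F z = z" if "g \<in> hom_set C z x" "z \<noteq> x" for g z
      using min[of z] that hom_Obj(1)[OF that(1)] by blast
    have y: "?y \<in> Obj C" "omap F ?y = ?y"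
      using hom_Obj(1)[OF \<eta>[OF x(1)]] below[OF \<eta>[OF x(1)] x(2)] by simp_all
    \<comment> \<open>The object \<open>?y\<close> lies strictly below \<open>x\<close>, hence is
      fixed, which makes \<open>amap F (\<eta> x)\<close> an endomorphism. Applying \<open>F\<close>
      to a factorisation of \<open>g\<close> through \<open>\<eta> x\<close> then returns the factor
      itself, whence its uniqueness.\<close>
    have F\<eta>: "amap F (\<eta> x) = Ident C ?y"
      using F_hom[OF \<eta>[OF x(1)]] y endo_Ident by simp
    have "\<exists>!h. h \<in> hom_set C z ?y \<and> g = Comp C (\<eta> x) h"
      if g: "g \<in> hom_set C z x" and "\<not> is_identity C g" for z g
    proof (rule ex1I[of _ "amap F g"])
      have z: "omap F z = z" using below[OF g] non_identity_neq[OF that] by blast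
      show "amap F g \<in> hom_set C z ?y \<and> g = Comp C (\<eta> x) (amap F g)"
        using F_hom[OF g] z nat[OF g] \<eta>_Ident[OF hom_Obj(1)[OF g] z] Comp_Ident_right[OF g] by simp
      fix h assume h: "h \<in> hom_set C z ?y \<and> g = Comp C (\<eta> x) h"
      then have "amap F h = h" using fixed z y by blast
      then have "amap F g = Comp C (Ident C ?y) h"
        using functor_Comp[OF F, of h z ?y "\<eta> x" x] h \<eta>[OF x(1)] F\<eta> by simp
      then show "h = amap F g" using h Comp_Ident_left by metis
    qed
    then have "down_beat_object C x"
      unfolding down_beat_object_def
      using x y(1) \<eta>[OF x(1)] not_identity[OF \<eta>[OF x(1)] x(2)]
      by (intro conjI bexI[of _ ?y] bexI[of _ "\<eta> x"]) auto
    then show False using no_beat by blast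
  qed
  show "x \<in> Obj C \<Longrightarrow> omap F x = x" by (rule obj)
  show "f \<in> Arr C \<Longrightarrow> amap F f = f"
    using fixed[OF Arr_hom] obj hom_Obj[OF Arr_hom] by blast
qed

text \<open>Along the zigzag each functor reached agrees with the identity on \<open>C\<close>, so
  the next natural map may be taken to start or end at \<open>id_functor\<close>. An arrow out of
  the identity becomes one into it in the opposite category, where up beat objects are excluded in
  place of down beat objects.\<close>

lemma equivclp_id_rigid:
  assumes "finite_acyclic_category C" and no_beat: "\<And>x. \<not> beat_object C x"
    and "equivclp (natural_map C C) id_functor F"
  shows "(\<forall>x\<in>Obj C. omap F x = x) \<and> (\<forall>f\<in>Arr C. amap F f = f)"
  using assms(3)
proof (induction rule: equivclp_induct)
  case (step F G)
  interpret finite_acyclic_category C by fact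
  interpret op: finite_acyclic_category "opposite C"
    using assms(1) by (rule finite_acyclic_category_opposite)
  have down: "\<And>x. \<not> down_beat_object C x" and up: "\<And>x. \<not> down_beat_object (opposite C) x"
    using no_beat by (simp_all add: beat_object_def up_beat_object_def)
  from step.hyps(2) show ?case
  proof
    assume "natural_map C C F G"
    then have "natural_map C C id_functor G"
      by (rule natural_map_cong[OF category_axioms]) (use step.IH in simp_all)
    then have "natural_map (opposite C) (opposite C) G id_functor"
      by (rule natural_map_opposite[OF category_axioms])
    from natural_map_to_id_rigid[OF op.finite_acyclic_category_axioms up this] show ?case
      by simp
  next
    assume "natural_map C C G F"
    then have "natural_map C C G id_functor"
      by (rule natural_map_cong[OF category_axioms]) (use step.IH in simp_all)
    from natural_map_to_id_rigid[OF assms(1) down this] show ?case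
      by simp
  qed
qed simp

lemma ex_beat_free_strong_collapse:
  assumes "finite_acyclic_category C"
  obtains D where "strong_collapse C D" "finite_acyclic_category D" "\<And>x. \<not> beat_object D x"
proof -
  have "\<exists>D. strong_collapse C D \<and> finite_acyclic_category D \<and> (\<forall>x. \<not> beat_object D x)"
    using assms
  proof (induction "card (Obj C)" arbitrary: C rule: less_induct)
    case less
    show ?case
    proof (cases "\<exists>x. beat_object C x")
      case True
      then obtain x where x: "beat_object C x" ..
      then have "x \<in> Obj C"
        by (auto simp: beat_object_def up_beat_object_def down_beat_object_def)
      let ?E = "full_subcategory C (Obj C - {x})"
      have "card (Obj ?E) < card (Obj C)"
        using \<open>x \<in> Obj C\<close> finite_acyclic_category.finite_Obj[OF less.prems]
        by (intro psubset_card_mono) auto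
      then obtain D where D: "strong_collapse ?E D" "finite_acyclic_category D"
          "\<forall>x. \<not> beat_object D x"
        using less.hyps finite_acyclic_category_full[OF less.prems] by blast
      have "elementary_strong_collapse C ?E"
        using x unfolding elementary_strong_collapse_def by blast
      then show ?thesis
        using D unfolding strong_collapse_def by (meson converse_rtranclp_into_rtranclp)
    next
      case False
      then show ?thesis using less.prems unfolding strong_collapse_def by blast
    qed
  qed
  then show thesis using that by blast
qed

lemma elementary_strong_collapse_opposite:
  assumes "elementary_strong_collapse C D"
  shows "elementary_strong_collapse (opposite C) (opposite D)"
  using assms unfolding elementary_strong_collapse_def beat_object_def up_beat_object_def
  by (auto simp: full_opposite)

lemma strong_collapse_opposite:
  "strong_collapse C D \<Longrightarrow> strong_collapse (opposite C) (opposite D)"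
  unfolding strong_collapse_def
  by (induction rule: rtranclp_induct)
    (auto intro: rtranclp.rtrancl_into_rtrancl elementary_strong_collapse_opposite)

lemma elementary_strong_collapse_finite_acyclic:
  "finite_acyclic_category C \<Longrightarrow> elementary_strong_collapse C D \<Longrightarrow> finite_acyclic_category D"
  by (auto simp: elementary_strong_collapse_def finite_acyclic_category_full)

lemma elementary_strong_collapse_homotopy_equivalent:
  assumes "finite_acyclic_category C" "elementary_strong_collapse C D"
  shows "strongly_homotopy_equivalent C D"
proof -
  interpret finite_acyclic_category C by fact
  interpret op: finite_acyclic_category "opposite C"
    using assms(1) by (rule finite_acyclic_category_opposite)
  obtain x where x: "beat_object C x" and D: "D = full_subcategory C (Obj C - {x})"
    using assms(2) unfolding elementary_strong_collapse_def by blast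
  show ?thesis
  proof (cases "down_beat_object C x")
    case True
    then show ?thesis unfolding D
      using coreflective_strongly_homotopy_equivalent[OF category_axioms]
        down_beat_coreflective[OF acyclic_category_axioms] by blast
  next
    case False
    then have "down_beat_object (opposite C) x"
      using x by (simp add: beat_object_def up_beat_object_def)
    then have "strongly_homotopy_equivalent (opposite C) (opposite D)"
      using coreflective_strongly_homotopy_equivalent[OF op.category_axioms
          down_beat_coreflective[OF op.acyclic_category_axioms]] D
      by (simp add: full_opposite)
    then have "strongly_homotopy_equivalent (opposite (opposite C)) (opposite (opposite D))"
      by (rule strongly_homotopy_equivalent_opposite[rotated 2])
        (simp_all add: op.category_axioms D category_full category_axioms category_opposite)
    then show ?thesis by simp
  qed
qed

lemma finite_acyclic_category_is_category: "finite_acyclic_category C \<Longrightarrow> category C"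
  by (simp add: finite_acyclic_category_def acyclic_category_def)

lemma strong_collapse_finite_acyclic_homotopy_equivalent:
  assumes "finite_acyclic_category C" "strong_collapse C D"
  shows "finite_acyclic_category D \<and> strongly_homotopy_equivalent C D"
  using assms(2) unfolding strong_collapse_def
proof (induction rule: rtranclp_induct)
  case base
  then show ?case using assms(1) by (simp add: strongly_homotopy_equivalent_refl)
next
  case (step D E)
  then have "finite_acyclic_category E"
    using elementary_strong_collapse_finite_acyclic by blast
  moreover have "strongly_homotopy_equivalent C E"
    using strongly_homotopy_equivalent_trans[of C D E] step assms(1) calculation
      elementary_strong_collapse_homotopy_equivalent finite_acyclic_category_is_category by blast
  ultimately show ?case ..
qed

text \<open>Only the larger category is required to be finite acyclic, because collapses inherit
  this. Building the condition into the relation keeps every category of an \<open>equivclp\<close>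
  chain from a finite acyclic start within the permitted class.\<close>

definition finite_collapse :: "('o, 'm) category \<Rightarrow> ('o, 'm) category \<Rightarrow> bool" where
  "finite_collapse C D \<longleftrightarrow> finite_acyclic_category C \<and> strong_collapse C D"

lemma same_strong_equivalence_type_iff_equivclp:
  assumes "finite_acyclic_category A"
  shows "same_strong_equivalence_type A B \<longleftrightarrow> equivclp finite_collapse A B"
proof
  assume "same_strong_equivalence_type A B"
  then obtain n :: nat and C where C: "C 0 = A" "C n = B" "\<forall>i\<le>n. finite_acyclic_category (C i)"
    "\<forall>i<n. strong_collapse (C i) (C (Suc i)) \<or> strong_collapse (C (Suc i)) (C i)"
    unfolding same_strong_equivalence_type_def by blast
  then have "\<forall>i<n. symclp finite_collapse (C i) (C (Suc i))"
    by (simp add: symclp_def finite_collapse_def)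
  then show "equivclp finite_collapse A B"
    unfolding equivclp_def rtranclp_power relpowp_fun_conv using C by blast
next
  assume "equivclp finite_collapse A B"
  then obtain n :: nat and C where C: "C 0 = A" "C n = B"
    "\<forall>i<n. symclp finite_collapse (C i) (C (Suc i))"
    unfolding equivclp_def rtranclp_power relpowp_fun_conv by blast
  have "finite_acyclic_category (C i)" if "i \<le> n" for i
  proof (cases i)
    case 0
    then show ?thesis using C(1) assms by simp
  next
    case (Suc j)
    then have "symclp finite_collapse (C j) (C i)" using C(3) that by simp
    then show ?thesis
      using strong_collapse_finite_acyclic_homotopy_equivalent
      by (auto simp: symclp_def finite_collapse_def)
  qed
  then show "same_strong_equivalence_type A B"
    unfolding same_strong_equivalence_type_def using C
    by (intro exI[of _ n] exI[of _ C]) (auto simp: symclp_def finite_collapse_def)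
qed

lemma equivclp_finite_collapse_homotopy_equivalent:
  assumes "finite_acyclic_category A" "equivclp finite_collapse A B"
  shows "finite_acyclic_category B \<and> strongly_homotopy_equivalent A B"
  using assms(2)
proof (induction rule: equivclp_induct)
  case base
  then show ?case using assms(1) by (simp add: strongly_homotopy_equivalent_refl)
next
  case (step B D)
  then have "finite_acyclic_category D \<and> strongly_homotopy_equivalent B D"
    using strong_collapse_finite_acyclic_homotopy_equivalent strongly_homotopy_equivalent_sym
    unfolding finite_collapse_def by blast
  then show ?case
    using strongly_homotopy_equivalent_trans[of A B D] step.IH assms(1)
      finite_acyclic_category_is_category by blast
qed

subsection \<open>Isomorphisms and transport of structure\<close>

text \<open>The equations are restricted to objects and arrows because functor maps have arbitrary
  values elsewhere.\<close>

definition inverse_functors :: "('o, 'm) category \<Rightarrow> ('p, 'n) category \<Rightarrow>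
    ('o, 'm, 'p, 'n) functor_maps \<Rightarrow> ('p, 'n, 'o, 'm) functor_maps \<Rightarrow> bool" where
  "inverse_functors A B F G \<longleftrightarrow> is_functor A B F \<and> is_functor B A G \<and>
    (\<forall>x\<in>Obj A. omap G (omap F x) = x) \<and> (\<forall>f\<in>Arr A. amap G (amap F f) = f) \<and>
    (\<forall>y\<in>Obj B. omap F (omap G y) = y) \<and> (\<forall>g\<in>Arr B. amap F (amap G g) = g)"

lemma inverse_functors_sym: "inverse_functors A B F G \<Longrightarrow> inverse_functors B A G F"
  by (simp add: inverse_functors_def)

lemma inverse_functors_comp:
  assumes "category A" "category B" "category C"
    and "inverse_functors A B F G" "inverse_functors B C F' G'"
  shows "inverse_functors A C (comp_functor F' F) (comp_functor G G')"
proof -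
  have F: "is_functor A B F" "is_functor B A G" "is_functor B C F'" "is_functor C B G'"
    using assms(4,5) by (simp_all add: inverse_functors_def)
  note maps = functor_Obj[OF F(1)] functor_Obj[OF F(4)]
    functor_Arr[OF assms(1) F(1)] functor_Arr[OF assms(3) F(4)]
  show ?thesis
    using assms(4,5) maps is_functor_comp[OF assms(1,2) F(1,3)] is_functor_comp[OF assms(3,2) F(4,2)]
    by (simp add: inverse_functors_def)
qed

lemma inverse_functors_opposite:
  "category A \<Longrightarrow> category B \<Longrightarrow> inverse_functors A B F G \<Longrightarrow>
    inverse_functors (opposite A) (opposite B) F G"
  by (simp add: inverse_functors_def is_functor_opposite)

text \<open>Coreflectivity is checked on the cylinder itself and carried by this lemma to its
  renamed copy.\<close>

lemma inverse_functors_coreflective: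
  assumes "category A" "category B" "inverse_functors A B F G" "coreflective A S"
  shows "coreflective B (omap F ` S)"
  unfolding coreflective_def
proof (intro conjI ballI)
  interpret A: category A by fact
  interpret B: category B by fact
  have F: "is_functor A B F" and G: "is_functor B A G"
    and GF: "\<And>x. x \<in> Obj A \<Longrightarrow> omap G (omap F x) = x" "\<And>f. f \<in> Arr A \<Longrightarrow> amap G (amap F f) = f"
    and FG: "\<And>y. y \<in> Obj B \<Longrightarrow> omap F (omap G y) = y" "\<And>g. g \<in> Arr B \<Longrightarrow> amap F (amap G g) = g"
    using assms(3) by (auto simp: inverse_functors_def)
  have S: "S \<subseteq> Obj A" using assms(4) by (simp add: coreflective_def)
  then show "omap F ` S \<subseteq> Obj B" using functor_Obj[OF F] by auto
  fix x assume x: "x \<in> Obj B"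
  then obtain s e where "universal_arrow A S (omap G x) s e"
    using assms(4) functor_Obj[OF G x] unfolding coreflective_def by blast
  note univ = universal_arrowD[OF this]
  have e: "amap F e \<in> hom_set B (omap F s) x"
    using functor_hom[OF assms(1) F univ(2)] FG(1)[OF x] by simp
  have "\<exists>!h. h \<in> hom_set B (omap F z) (omap F s) \<and> g = Comp B (amap F e) h"
    if z: "z \<in> S" and g: "g \<in> hom_set B (omap F z) x" for z g
  proof -
    have zs: "z \<in> Obj A" "s \<in> Obj A" using z univ(1) S by auto
    have Gg: "amap G g \<in> hom_set A z (omap G x)"
      using functor_hom[OF assms(2) G g] GF(1)[OF zs(1)] by simp
    obtain h where h: "h \<in> hom_set A z s" "amap G g = Comp A e h"
      and uniq: "\<And>h'. h' \<in> hom_set A z s \<Longrightarrow> amap G g = Comp A e h' \<Longrightarrow> h' = h"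
      using univ(3)[OF z Gg] by metis
    show ?thesis
    proof (rule ex1I[of _ "amap F h"])
      show "amap F h \<in> hom_set B (omap F z) (omap F s) \<and> g = Comp B (amap F e) (amap F h)"
        using functor_hom[OF assms(1) F h(1)] functor_Comp[OF F h(1) univ(2)] h(2)
          FG(2) B.hom_Obj(3)[OF g] by metis
      fix k assume k: "k \<in> hom_set B (omap F z) (omap F s) \<and> g = Comp B (amap F e) k"
      then have "amap G k \<in> hom_set A z s"
        using functor_hom[OF assms(2) G, of k] GF(1) zs by fastforce
      moreover have "amap G g = Comp A e (amap G k)"
        using functor_Comp[OF G, of k "omap F z" "omap F s" "amap F e" x] k e
          GF(2)[OF A.hom_Obj(3)[OF univ(2)]] by simp
      ultimately have "amap G k = h" by (rule uniq)
      then show "k = amap F h" using FG(2) k B.hom_Obj(3) by metis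
    qed
  qed
  then have "universal_arrow B (omap F ` S) x (omap F s) (amap F e)"
    using univ(1) e by (simp add: universal_arrow_def)
  then show "\<exists>s e. universal_arrow B (omap F ` S) x s e" by blast
qed

lemma inverse_functors_finite_acyclic:
  assumes "finite_acyclic_category A" "category B" "inverse_functors A B F G"
  shows "finite_acyclic_category B"
proof -
  interpret A: finite_acyclic_category A by fact
  interpret B: category B by fact
  have F: "is_functor A B F" and G: "is_functor B A G"
    and FG: "\<And>y. y \<in> Obj B \<Longrightarrow> omap F (omap G y) = y" "\<And>g. g \<in> Arr B \<Longrightarrow> amap F (amap G g) = g"
    using assms(3) by (auto simp: inverse_functors_def)
  note G_hom = functor_hom[OF assms(2) G]
  show ?thesis
  proof
    fix x y assume xy: "x \<in> Obj B" "y \<in> Obj B" "x \<noteq> y" and "hom_set B y x \<noteq> {}"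
    then have "hom_set A (omap G y) (omap G x) \<noteq> {}" using G_hom by blast
    moreover have "omap G x \<noteq> omap G y" using xy FG(1) by metis
    ultimately have "hom_set A (omap G x) (omap G y) = {}"
      using A.hom_antisym functor_Obj[OF G] xy by blast
    then show "hom_set B x y = {}" using G_hom by blast
  next
    fix x f assume x: "x \<in> Obj B" and f: "f \<in> hom_set B x x"
    then have "amap G f = Ident A (omap G x)"
      using A.endo_Ident G_hom functor_Obj[OF G] by blast
    then have "amap F (amap G f) = Ident B x"
      using functor_Ident[OF F functor_Obj[OF G x]] FG(1)[OF x] by simp
    then show "f = Ident B x" using FG(2) B.hom_Obj(3)[OF f] by simp
  next
    have "Obj B \<subseteq> omap F ` Obj A"
      using FG(1) functor_Obj[OF G] by (metis image_eqI subsetI)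
    then show "finite (Obj B)" using A.finite_Obj finite_surj by blast
    have "Arr B \<subseteq> amap F ` Arr A"
      using FG(2) functor_Arr[OF assms(2) G] by (metis image_eqI subsetI)
    then show "finite (Arr B)" using A.finite_Arr finite_surj by blast
  qed
qed

text \<open>Here \<open>F\<close> is just a pair of renamings, expected to be injective on objects
  and on arrows; the structure is pulled back along their inverses. The target types are free, which
  permits moving a category over product types into \<open>'o\<close> and \<open>'m\<close>. Off the
  image everything is \<open>undefined\<close>, as \<open>category\<close> demands.\<close>

definition transport ::
    "('o, 'm) category \<Rightarrow> ('o, 'm, 'p, 'n) functor_maps \<Rightarrow> ('p, 'n) category" where
  "transport C F = (let Ar = amap F ` Arr C; pre = inv_into (Arr C) (amap F) in
    \<lparr>Obj = omap F ` Obj C, Arr = Ar,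
     Dom = restrict (\<lambda>f. omap F (Dom C (pre f))) Ar,
     Cod = restrict (\<lambda>f. omap F (Cod C (pre f))) Ar,
     Ident = restrict (\<lambda>x. amap F (Ident C (inv_into (Obj C) (omap F) x))) (omap F ` Obj C),
     Comp = (\<lambda>g f. if f \<in> Ar \<and> g \<in> Ar \<and> composable C (pre g) (pre f)
       then amap F (Comp C (pre g) (pre f)) else undefined)\<rparr>)"

lemma
  shows Obj_transport: "Obj (transport C F) = omap F ` Obj C"
    and Arr_transport: "Arr (transport C F) = amap F ` Arr C"
  by (simp_all add: transport_def Let_def)

lemma transport_inverse_functors:
  assumes "category C" and "inj_on (omap F) (Obj C)" "inj_on (amap F) (Arr C)"
  shows "category (transport C F)"
    and "\<exists>G. inverse_functors C (transport C F) F G"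
proof -
  interpret category C by fact
  let ?D = "transport C F"
  have Ident_D: "Ident ?D (omap F x) = amap F (Ident C x)" if "x \<in> Obj C" for x
    using that assms by (simp add: transport_def Let_def)
  have Comp_D: "Comp ?D (amap F g) (amap F f) = amap F (Comp C g f)"
    if "f \<in> hom_set C x y" "g \<in> hom_set C y z" for f g x y z
    using that hom_Obj(3)[OF that(1)] hom_Obj(3)[OF that(2)] assms
    by (auto simp: transport_def Let_def composable_iff)
  have hom_D: "f \<in> hom_set ?D u v \<longleftrightarrow>
      (\<exists>x y f'. f' \<in> hom_set C x y \<and> f = amap F f' \<and> u = omap F x \<and> v = omap F y)" for f u v
    using assms by (auto simp: hom_set_def transport_def Let_def)
  \<comment> \<open>A preimage of an arrow comes with some preimage of its source. Injectivity on
    objects identifies that source with a prescribed one, so preimages of consecutive arrows are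
    composable in \<open>C\<close>.\<close>
  have hom_D_Obj: "\<exists>y f'. f' \<in> hom_set C x y \<and> f = amap F f' \<and> v = omap F y"
    if x: "x \<in> Obj C" and f: "f \<in> hom_set ?D (omap F x) v" for x f v
  proof -
    obtain x' y f' where *: "f' \<in> hom_set C x' y" "f = amap F f'" "omap F x = omap F x'" "v = omap F y"
      using f unfolding hom_D by blast
    then have "x' = x" using inj_onD[OF assms(2)] x hom_Obj(1) by metis
    then show ?thesis using * by blast
  qed
  show "category ?D"
  proof
    show "Dom ?D \<in> Arr ?D \<rightarrow>\<^sub>E Obj ?D" "Cod ?D \<in> Arr ?D \<rightarrow>\<^sub>E Obj ?D"
      using assms(3) Dom_PiE Cod_PiE by (auto simp: transport_def Let_def)
    show "Ident ?D \<in> extensional (Obj ?D)" by (simp add: transport_def Let_def)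
  next
    fix x assume "x \<in> Obj ?D"
    then obtain x' where "x' \<in> Obj C" "x = omap F x'" by (auto simp: Obj_transport)
    then show "Ident ?D x \<in> hom_set ?D x x"
      using Ident_hom Ident_D unfolding hom_D by blast
  next
    fix g f assume nc: "\<not> composable ?D g f"
    show "Comp ?D g f = undefined"
    proof (rule ccontr)
      assume "Comp ?D g f \<noteq> undefined"
      then have "f \<in> amap F ` Arr C" "g \<in> amap F ` Arr C"
        and comp: "composable C (inv_into (Arr C) (amap F) g) (inv_into (Arr C) (amap F) f)"
        by (simp_all add: transport_def Let_def split: if_splits)
      then obtain f' g' where fg: "f = amap F f'" "g = amap F g'" "f' \<in> Arr C" "g' \<in> Arr C"
        by blast
      then have "composable C g' f'" using comp assms(3) by simp
      then have "composable ?D g f"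
        unfolding composable_iff[of C] composable_iff[of ?D] hom_D fg(1,2) by blast
      then show False using nc by simp
    qed
  next
    fix w' x' y' z' f' g' h'
    assume f': "f' \<in> hom_set ?D w' x'"
    then obtain w x f where f: "f \<in> hom_set C w x" "f' = amap F f" "w' = omap F w" "x' = omap F x"
      unfolding hom_D by blast
    note wx = hom_Obj(1,2)[OF f(1)]
    show "Comp ?D (Ident ?D x') f' = f'" "Comp ?D f' (Ident ?D w') = f'"
      using f wx Ident_hom Comp_Ident_left[OF f(1)] Comp_Ident_right[OF f(1)]
        Comp_D[OF f(1) Ident_hom] Comp_D[OF Ident_hom f(1)] by (simp_all add: Ident_D)
    assume "g' \<in> hom_set ?D x' y'"
    then obtain g y where g: "g \<in> hom_set C x y" "g' = amap F g" "y' = omap F y"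
      using hom_D_Obj[OF wx(2)] f(4) by blast
    show gf: "Comp ?D g' f' \<in> hom_set ?D w' y'"
      using Comp_D[OF f(1) g(1)] Comp_hom[OF f(1) g(1)] f g unfolding hom_D by blast
    assume "h' \<in> hom_set ?D y' z'"
    then obtain h z where h: "h \<in> hom_set C y z" "h' = amap F h"
      using hom_D_Obj[OF hom_Obj(2)[OF g(1)]] g(3) by blast
    show "Comp ?D h' (Comp ?D g' f') = Comp ?D (Comp ?D h' g') f'"
      using Comp_D[OF f(1) g(1)] Comp_D[OF g(1) h(1)] Comp_D[OF Comp_hom[OF f(1) g(1)] h(1)]
        Comp_D[OF f(1) Comp_hom[OF g(1) h(1)]] Comp_assoc[OF f(1) g(1) h(1)] f(2) g(2) h(2)
      by simp
  qed
  let ?G = "\<lparr>omap = inv_into (Obj C) (omap F), amap = inv_into (Arr C) (amap F)\<rparr>"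
  have "is_functor C ?D F"
  proof (rule is_functorI)
    fix x y f assume "f \<in> hom_set C x y"
    then show "amap F f \<in> hom_set ?D (omap F x) (omap F y)" unfolding hom_D by blast
  qed (auto simp: Obj_transport Ident_D Comp_D)
  moreover have "is_functor ?D C ?G"
  proof (rule is_functorI)
    fix x assume "x \<in> Obj ?D"
    then show "omap ?G x \<in> Obj C" "amap ?G (Ident ?D x) = Ident C (omap ?G x)"
      using assms(2,3) Ident_hom hom_Obj(3)[OF Ident_hom] by (auto simp: Obj_transport Ident_D)
  next
    fix x' y' f' assume "f' \<in> hom_set ?D x' y'"
    then obtain x y f where f: "f \<in> hom_set C x y" "f' = amap F f" "x' = omap F x" "y' = omap F y"
      unfolding hom_D by blast
    note xy = hom_Obj[OF f(1)]
    show "amap ?G f' \<in> hom_set C (omap ?G x') (omap ?G y')"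
      using f xy assms(2,3) by simp
    fix g' z' assume "g' \<in> hom_set ?D y' z'"
    then obtain g z where g: "g \<in> hom_set C y z" "g' = amap F g"
      using hom_D_Obj[OF xy(2)] f(4) by blast
    show "amap ?G (Comp ?D g' f') = Comp C (amap ?G g') (amap ?G f')"
      using f g assms(3) hom_Obj(3)[OF f(1)] hom_Obj(3)[OF g(1)]
        hom_Obj(3)[OF Comp_hom[OF f(1) g(1)]] by (simp add: Comp_D)
  qed
  ultimately have "inverse_functors C ?D F ?G"
    unfolding inverse_functors_def using assms(2,3)
    by (auto simp: Obj_transport Arr_transport)
  then show "\<exists>G. inverse_functors C ?D F G" ..
qed

subsection \<open>Cylinders\<close>

text \<open>The two truth values in an arrow are its source and target level; with
  \<open>False\<close> below \<open>True\<close> they form the arrow of the two-element chain.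
  Keeping both makes the domain and the codomain functions of the arrow.\<close>

definition cylinder :: "('o, 'm) category \<Rightarrow> ('o \<times> bool, 'm \<times> bool \<times> bool) category" where
  "cylinder C = (let Ar = {(f, a, b). f \<in> Arr C \<and> a \<le> b} in
    \<lparr>Obj = Obj C \<times> UNIV, Arr = Ar,
     Dom = restrict (\<lambda>(f, a, b). (Dom C f, a)) Ar,
     Cod = restrict (\<lambda>(f, a, b). (Cod C f, b)) Ar,
     Ident = restrict (\<lambda>(x, a). (Ident C x, a, a)) (Obj C \<times> UNIV),
     Comp = (\<lambda>(g, b', c) (f, a, b).
       if composable C g f \<and> a \<le> b \<and> b = b' \<and> b' \<le> c then (Comp C g f, a, c) else undefined)\<rparr>)"

definition level :: "bool \<Rightarrow> ('o, 'm, 'o \<times> bool, 'm \<times> bool \<times> bool) functor_maps" where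
  "level a = \<lparr>omap = \<lambda>x. (x, a), amap = \<lambda>f. (f, a, a)\<rparr>"

lemma
  shows Obj_cylinder: "Obj (cylinder C) = Obj C \<times> UNIV"
    and Arr_cylinder: "Arr (cylinder C) = {(f, a, b). f \<in> Arr C \<and> a \<le> b}"
    and hom_cylinder:
      "t \<in> hom_set (cylinder C) u v \<longleftrightarrow>
        (\<exists>f. f \<in> hom_set C (fst u) (fst v) \<and> t = (f, snd u, snd v) \<and> snd u \<le> snd v)"
    and Ident_cylinder: "x \<in> Obj C \<Longrightarrow> Ident (cylinder C) (x, a) = (Ident C x, a, a)"
    and Comp_cylinder: "f \<in> hom_set C x y \<Longrightarrow> g \<in> hom_set C y z \<Longrightarrow> a \<le> b \<Longrightarrow> b \<le> c \<Longrightarrow>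
      Comp (cylinder C) (g, b, c) (f, a, b) = (Comp C g f, a, c)"
  by (cases u; cases v; auto simp: cylinder_def Let_def hom_set_def composable_def)+

lemma finite_acyclic_category_cylinder:
  assumes "finite_acyclic_category C"
  shows "finite_acyclic_category (cylinder C)"
proof -
  interpret finite_acyclic_category C by fact
  let ?Z = "cylinder C"
  show ?thesis
  proof
    show "Dom ?Z \<in> Arr ?Z \<rightarrow>\<^sub>E Obj ?Z" "Cod ?Z \<in> Arr ?Z \<rightarrow>\<^sub>E Obj ?Z"
      using Dom_PiE Cod_PiE by (auto simp: cylinder_def Let_def)
    show "Ident ?Z \<in> extensional (Obj ?Z)" by (simp add: cylinder_def Let_def)
  next
    fix x assume "x \<in> Obj ?Z"
    then show "Ident ?Z x \<in> hom_set ?Z x x"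
      using Ident_hom by (cases x) (simp add: Obj_cylinder Ident_cylinder hom_cylinder)
  next
    fix g f assume "\<not> composable ?Z g f"
    then show "Comp ?Z g f = undefined"
      by (cases f; cases g) (auto simp: cylinder_def Let_def composable_def)
  next
    fix w' x' y' z' f' g' h'
    assume "f' \<in> hom_set ?Z w' x'"
    then obtain w x f a b where f: "f \<in> hom_set C w x" "f' = (f, a, b)" "a \<le> b"
      and wx: "w' = (w, a)" "x' = (x, b)"
      by (cases w'; cases x') (auto simp: hom_cylinder)
    show "Comp ?Z (Ident ?Z x') f' = f'" "Comp ?Z f' (Ident ?Z w') = f'"
      using f wx hom_Obj[OF f(1)] Comp_cylinder[OF f(1) Ident_hom f(3)]
        Comp_cylinder[OF Ident_hom f(1) _ f(3)]
      by (simp_all add: Ident_cylinder Comp_Ident_left Comp_Ident_right)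
    assume "g' \<in> hom_set ?Z x' y'"
    then obtain y g c where g: "g \<in> hom_set C x y" "g' = (g, b, c)" "b \<le> c" and y: "y' = (y, c)"
      using wx by (cases y') (auto simp: hom_cylinder)
    have gf: "Comp C g f \<in> hom_set C w y" and ac: "a \<le> c"
      using Comp_hom[OF f(1) g(1)] f(3) g(3) by auto
    show "Comp ?Z g' f' \<in> hom_set ?Z w' y'"
      using Comp_cylinder[OF f(1) g(1) f(3) g(3)] gf ac f(2) g(2) wx y
      by (simp add: hom_cylinder)
    assume "h' \<in> hom_set ?Z y' z'"
    then obtain z h d where h: "h \<in> hom_set C y z" "h' = (h, c, d)" "c \<le> d" and z: "z' = (z, d)"
      using y by (cases z') (auto simp: hom_cylinder)
    have hg: "Comp C h g \<in> hom_set C x z" and bd: "b \<le> d"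
      using Comp_hom[OF g(1) h(1)] g(3) h(3) by auto
    show "Comp ?Z h' (Comp ?Z g' f') = Comp ?Z (Comp ?Z h' g') f'"
      unfolding f(2) g(2) h(2)
      using Comp_cylinder[OF f(1) g(1) f(3) g(3)] Comp_cylinder[OF g(1) h(1) g(3) h(3)]
        Comp_cylinder[OF gf h(1) ac h(3)] Comp_cylinder[OF f(1) hg f(3) bd]
        Comp_assoc[OF f(1) g(1) h(1)] by simp
  next
    fix x y :: "'a \<times> bool"
    assume *: "x \<in> Obj ?Z" "y \<in> Obj ?Z" "x \<noteq> y" "hom_set ?Z y x \<noteq> {}"
    show "hom_set ?Z x y = {}"
    proof (rule ccontr)
      assume "hom_set ?Z x y \<noteq> {}"
      then have "snd x = snd y" "hom_set C (fst x) (fst y) \<noteq> {}" "hom_set C (fst y) (fst x) \<noteq> {}"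
        using * by (auto simp: hom_cylinder)
      then show False
        using * hom_antisym[of "fst x" "fst y"] by (auto simp: prod_eq_iff Obj_cylinder)
    qed
  next
    fix x f assume "x \<in> Obj ?Z" "f \<in> hom_set ?Z x x"
    then show "f = Ident ?Z x"
      using endo_Ident by (cases x) (auto simp: Obj_cylinder hom_cylinder Ident_cylinder)
  next
    show "finite (Obj ?Z)" using finite_Obj by (simp add: Obj_cylinder)
    have "Arr ?Z \<subseteq> Arr C \<times> UNIV" by (auto simp: Arr_cylinder)
    then show "finite (Arr ?Z)" using finite_Arr finite_subset by fastforce
  qed
qed

lemma is_functor_level:
  assumes "category C"
  shows "is_functor C (cylinder C) (level a)"
  by (rule is_functorI)
    (auto simp: level_def Obj_cylinder hom_cylinder Ident_cylinder Comp_cylinder)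

text \<open>From level \<open>False\<close>, an arrow to \<open>(x, a)\<close> carries the same data
  whatever \<open>a\<close> is. It therefore factors uniquely through the vertical arrow from
  \<open>(x, False)\<close> to \<open>(x, a)\<close>.\<close>

lemma cylinder_coreflective:
  assumes "category C"
  shows "coreflective (cylinder C) (Obj C \<times> {False})"
  unfolding coreflective_def
proof (intro conjI ballI)
  interpret category C by fact
  let ?Z = "cylinder C"
  show "Obj C \<times> {False} \<subseteq> Obj ?Z" by (auto simp: Obj_cylinder)
  fix u assume "u \<in> Obj ?Z"
  then obtain x a where u: "u = (x, a)" "x \<in> Obj C" by (cases u) (simp add: Obj_cylinder)
  let ?e = "(Ident C x, False, a)"
  have "\<exists>!h. h \<in> hom_set ?Z v (x, False) \<and> t = Comp ?Z ?e h"
    if v: "v \<in> Obj C \<times> {False}" and t: "t \<in> hom_set ?Z v (x, a)" for v t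
  proof -
    obtain z g where z: "v = (z, False)" and g: "g \<in> hom_set C z x" "t = (g, False, a)"
      using v t by (auto simp: hom_cylinder)
    have comp: "Comp ?Z ?e (k, False, False) = (k, False, a)" if "k \<in> hom_set C z x" for k
      using Comp_cylinder[OF that Ident_hom[OF u(2)], of False False a] Comp_Ident_left[OF that]
      by simp
    show ?thesis
      by (rule ex1I[of _ "(g, False, False)"]) (use comp g z in \<open>auto simp: hom_cylinder\<close>)
  qed
  then have "universal_arrow ?Z (Obj C \<times> {False}) u (x, False) ?e"
    using u Ident_hom[OF u(2)] by (simp add: universal_arrow_def hom_cylinder)
  then show "\<exists>s e. universal_arrow ?Z (Obj C \<times> {False}) u s e" by blast
qed

lemma cylinder_reflective:
  assumes "category C"
  shows "coreflective (opposite (cylinder C)) (Obj C \<times> {True})"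
  unfolding coreflective_def
proof (intro conjI ballI)
  interpret category C by fact
  let ?Z = "cylinder C"
  show "Obj C \<times> {True} \<subseteq> Obj (opposite ?Z)" by (auto simp: Obj_cylinder)
  fix u assume "u \<in> Obj (opposite ?Z)"
  then obtain x a where u: "u = (x, a)" "x \<in> Obj C" by (cases u) (simp add: Obj_cylinder)
  let ?e = "(Ident C x, a, True)"
  have "\<exists>!h. h \<in> hom_set ?Z (x, True) v \<and> t = Comp ?Z h ?e"
    if v: "v \<in> Obj C \<times> {True}" and t: "t \<in> hom_set ?Z (x, a) v" for v t
  proof -
    obtain z g where z: "v = (z, True)" and g: "g \<in> hom_set C x z" "t = (g, a, True)"
      using v t by (auto simp: hom_cylinder)
    have comp: "Comp ?Z (k, True, True) ?e = (k, a, True)" if "k \<in> hom_set C x z" for k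
      using Comp_cylinder[OF Ident_hom[OF u(2)] that, of a True True] Comp_Ident_right[OF that]
      by simp
    show ?thesis
      by (rule ex1I[of _ "(g, True, True)"]) (use comp g z in \<open>auto simp: hom_cylinder\<close>)
  qed
  then have "universal_arrow (opposite ?Z) (Obj C \<times> {True}) u (x, True) ?e"
    using u Ident_hom[OF u(2)] by (simp add: universal_arrow_def hom_cylinder)
  then show "\<exists>s e. universal_arrow (opposite ?Z) (Obj C \<times> {True}) u s e" by blast
qed

lemma ex_fresh_injection:
  assumes "infinite (UNIV :: 'b set)" "finite (X :: 'a set)" "finite (Y :: 'b set)"
  obtains h where "inj_on h X" "h ` X \<inter> Y = {}"
proof -
  have "infinite (- Y)" using assms(1,3) by (simp add: Compl_eq_Diff_UNIV)
  then obtain W where W: "finite W" "card W = card X" "W \<subseteq> - Y"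
    using infinite_arbitrarily_large by blast
  then obtain h where "bij_betw h X W"
    using finite_same_card_bij[OF assms(2), of W] by auto
  then show thesis using W(3) that[of h] by (auto simp: bij_betw_def)
qed

text \<open>This recognises an end of the renamed cylinder as the given category itself. A general
  \<open>F\<close> is allowed because the inclusions arise as composites that are the identity only
  on \<open>A\<close>; the last hypothesis is fullness.\<close>

lemma full_subcategory_eqI:
  assumes "category A" "category C" and F: "is_functor A C F"
    and "\<And>x. x \<in> Obj A \<Longrightarrow> omap F x = x" "\<And>f. f \<in> Arr A \<Longrightarrow> amap F f = f"
    and Arr: "{f \<in> Arr C. Dom C f \<in> Obj A \<and> Cod C f \<in> Obj A} \<subseteq> Arr A"
  shows "full_subcategory C (Obj A) = A"
proof (rule category_eqI[symmetric])
  interpret category A by fact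
  have id: "is_functor A C id_functor"
    by (rule is_functor_cong[OF assms(1) F]) (use assms(4,5) in simp_all)
  then show into: "is_functor A (full_subcategory C (Obj A)) id_functor"
    by (rule is_functor_into_full[OF assms(1)]) simp
  show "Obj A = Obj (full_subcategory C (Obj A))"
    using functor_Obj[OF id] by auto
  show "Arr A = Arr (full_subcategory C (Obj A))"
    using functor_Arr[OF assms(1) into] Arr by (auto simp: Arr_full)
qed (use assms(1,2) category_full in auto)

text \<open>The renamed cylinder collapses onto both ends: onto \<open>A\<close> directly, and onto
  \<open>B\<close> by working in the opposite category. Disjointness makes the renaming injective.
  Every object of the cylinder gets a name from \<open>A\<close> or \<open>B\<close>, so fresh names
  are needed for arrows only.\<close>

lemma disjoint_isomorphic_equivclp:
  fixes A B :: "('o, 'm) category"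
  assumes "infinite (UNIV :: 'm set)"
    and "finite_acyclic_category A" "finite_acyclic_category B" and inv: "inverse_functors A B F G"
    and disj: "Obj A \<inter> Obj B = {}" "Arr A \<inter> Arr B = {}"
  shows "equivclp finite_collapse A B"
proof -
  interpret A: finite_acyclic_category A by fact
  interpret B: finite_acyclic_category B by fact
  have F: "is_functor A B F" and G: "is_functor B A G"
    and GF: "\<And>x. x \<in> Obj A \<Longrightarrow> omap G (omap F x) = x" "\<And>f. f \<in> Arr A \<Longrightarrow> amap G (amap F f) = f"
    and FG: "\<And>y. y \<in> Obj B \<Longrightarrow> omap F (omap G y) = y" "\<And>g. g \<in> Arr B \<Longrightarrow> amap F (amap G g) = g"
    using inv by (auto simp: inverse_functors_def)
  note FO = functor_Obj[OF F] and FA = functor_Arr[OF A.category_axioms F]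
    and GO = functor_Obj[OF G] and GA = functor_Arr[OF B.category_axioms G]
  \<comment> \<open>The values of \<open>\<rho>\<close> will name the arrows crossing from level
    \<open>False\<close> to level \<open>True\<close>, which belong to neither end.\<close>
  obtain \<rho> where \<rho>: "inj_on \<rho> (Arr A)" "\<rho> ` Arr A \<inter> (Arr A \<union> Arr B) = {}"
    using ex_fresh_injection[OF assms(1) A.finite_Arr, of "Arr A \<union> Arr B"]
      A.finite_Arr B.finite_Arr by blast
  let ?Z = "cylinder A"
  \<comment> \<open>the cylinder is realised inside the given types so that its ends are literally \<open>A\<close> and \<open>B\<close>\<close>
  define T :: "('o \<times> bool, 'm \<times> bool \<times> bool, 'o, 'm) functor_maps" where
    "T = \<lparr>omap = \<lambda>(x, a). if a then omap F x else x,
      amap = \<lambda>(f, a, b). if a then amap F f else if b then \<rho> f else f\<rparr>"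
  have Z: "finite_acyclic_category ?Z" by (rule finite_acyclic_category_cylinder[OF assms(2)])
  interpret Z: finite_acyclic_category ?Z by fact
  have "inj_on (omap T) (Obj ?Z)"
    using disj(1) FO GF(1) by (auto simp: inj_on_def T_def Obj_cylinder; metis IntI empty_iff)
  moreover have "inj_on (amap T) (Arr ?Z)"
  proof (rule inj_onI)
    fix s t assume st: "s \<in> Arr ?Z" "t \<in> Arr ?Z" "amap T s = amap T t"
    obtain f a b g c d where *: "s = (f, a, b)" "t = (g, c, d)" by (metis prod_cases3)
    then have fg: "f \<in> Arr A" "g \<in> Arr A" "a \<le> b" "c \<le> d"
      using st by (auto simp: Arr_cylinder)
    have inj: "amap F f = amap F g \<longleftrightarrow> f = g" "\<rho> f = \<rho> g \<longleftrightarrow> f = g"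
      using fg GF(2) inj_on_eq_iff[OF \<rho>(1)] by metis+
    have "amap F f \<in> Arr B" "amap F g \<in> Arr B" using fg FA by auto
    then have "amap F f \<noteq> g" "f \<noteq> amap F g" "amap F f \<noteq> \<rho> g" "\<rho> f \<noteq> amap F g" "\<rho> f \<noteq> g" "f \<noteq> \<rho> g"
      using fg disj(2) \<rho>(2) by auto
    then show "s = t"
      using st(3) inj fg(3,4) unfolding *
      by (cases a; cases b; cases c; cases d) (simp_all add: T_def)
  qed
  ultimately obtain H where cat: "category (transport ?Z T)"
    and TH: "inverse_functors ?Z (transport ?Z T) T H"
    using transport_inverse_functors[OF Z.category_axioms, of T] by blast
  let ?C = "transport ?Z T"
  have C: "finite_acyclic_category ?C"
    by (rule inverse_functors_finite_acyclic[OF Z cat TH])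
  have T: "is_functor ?Z ?C T" using TH by (simp add: inverse_functors_def)
  have Arr_C: "\<exists>f a b. k = amap T (f, a, b) \<and> f \<in> Arr A \<and> a \<le> b \<and>
      Dom ?C k = omap T (Dom A f, a) \<and> Cod ?C k = omap T (Cod A f, b)" if k: "k \<in> Arr ?C" for k
  proof -
    obtain f a b where f: "k = amap T (f, a, b)" "f \<in> Arr A" "a \<le> b"
      using k by (auto simp: Arr_transport Arr_cylinder)
    have "(f, a, b) \<in> hom_set ?Z (Dom A f, a) (Cod A f, b)"
      using f A.Arr_hom by (simp add: hom_cylinder)
    from functor_hom[OF Z.category_axioms T this] show ?thesis
      using f by (auto simp: hom_set_def)
  qed
  have T_F: "omap T (x, True) = omap F x" "omap T (x, False) = x" for x
    by (simp_all add: T_def)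
  have FO': "omap F x \<notin> Obj A" if "x \<in> Obj A" for x using FO[OF that] disj(1) by blast
  have DC: "Dom A f \<in> Obj A" "Cod A f \<in> Obj A" if "f \<in> Arr A" for f
    using A.hom_Obj[OF A.Arr_hom[OF that]] by simp_all
  have full_A: "full_subcategory ?C (Obj A) = A"
  proof (rule full_subcategory_eqI[OF A.category_axioms cat])
    show "is_functor A ?C (comp_functor T (level False))"
      using is_functor_comp[OF A.category_axioms Z.category_axioms
          is_functor_level[OF A.category_axioms] T] .
    show "{f \<in> Arr ?C. Dom ?C f \<in> Obj A \<and> Cod ?C f \<in> Obj A} \<subseteq> Arr A"
    proof
      fix k assume "k \<in> {f \<in> Arr ?C. Dom ?C f \<in> Obj A \<and> Cod ?C f \<in> Obj A}"
      then have k: "k \<in> Arr ?C" "Dom ?C k \<in> Obj A" "Cod ?C k \<in> Obj A" by simp_all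
      obtain f a b where f: "k = amap T (f, a, b)" "f \<in> Arr A" "a \<le> b"
        "Dom ?C k = omap T (Dom A f, a)" "Cod ?C k = omap T (Cod A f, b)"
        using Arr_C[OF k(1)] by blast
      \<comment> \<open>A codomain on level \<open>True\<close> would be renamed into
        \<open>B\<close>. Since \<open>a \<le> b\<close>, excluding \<open>b\<close> excludes
        \<open>a\<close> too, so the codomain alone decides; for the other end the domain decides in
        the same way.\<close>
      then have "\<not> b" using k(3) FO' DC(2) T_F by (cases b) auto
      then show "k \<in> Arr A" using f by (simp add: T_def)
    qed
  qed (simp_all add: T_def level_def)
  have full_B: "full_subcategory ?C (Obj B) = B"
  proof (rule full_subcategory_eqI[OF B.category_axioms cat])
    show "is_functor B ?C (comp_functor (comp_functor T (level True)) G)"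
      using is_functor_comp[OF B.category_axioms A.category_axioms G
          is_functor_comp[OF A.category_axioms Z.category_axioms
            is_functor_level[OF A.category_axioms] T]] .
    show "{f \<in> Arr ?C. Dom ?C f \<in> Obj B \<and> Cod ?C f \<in> Obj B} \<subseteq> Arr B"
    proof
      fix k assume "k \<in> {f \<in> Arr ?C. Dom ?C f \<in> Obj B \<and> Cod ?C f \<in> Obj B}"
      then have k: "k \<in> Arr ?C" "Dom ?C k \<in> Obj B" "Cod ?C k \<in> Obj B" by simp_all
      obtain f a b where f: "k = amap T (f, a, b)" "f \<in> Arr A" "a \<le> b"
        "Dom ?C k = omap T (Dom A f, a)" "Cod ?C k = omap T (Cod A f, b)"
        using Arr_C[OF k(1)] by blast
      then have a using k(2) DC(1)[OF f(2)] T_F disj(1) by (cases a) auto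
      then show "k \<in> Arr B" using f FA by (simp add: T_def)
    qed
  qed (use FG in \<open>simp_all add: T_def level_def\<close>)
  have "omap T ` (Obj A \<times> {False}) = Obj A"
    by (auto simp: T_def image_def)
  then have "coreflective ?C (Obj A)"
    using inverse_functors_coreflective[OF Z.category_axioms cat TH
        cylinder_coreflective[OF A.category_axioms]] by simp
  then have CA: "strong_collapse ?C A"
    using coreflective_strong_collapse[OF C] full_A by metis
  have "omap F ` Obj A = Obj B"
    using FO GO FG(1) by (auto simp: image_iff) metis
  then have "omap T ` (Obj A \<times> {True}) = Obj B"
    by (auto simp: T_def image_def)
  then have "coreflective (opposite ?C) (Obj B)"
    using inverse_functors_coreflective[OF category_opposite[OF Z.category_axioms]
        category_opposite[OF cat] inverse_functors_opposite[OF Z.category_axioms cat TH]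
        cylinder_reflective[OF A.category_axioms]] by simp
  then have "strong_collapse (opposite ?C) (opposite B)"
    using coreflective_strong_collapse[OF finite_acyclic_category_opposite[OF C]] full_B
    by (metis full_opposite)
  then have CB: "strong_collapse ?C B"
    using strong_collapse_opposite by fastforce
  have "finite_collapse ?C A" "finite_collapse ?C B"
    using C CA CB by (simp_all add: finite_collapse_def)
  then show ?thesis
    by (meson equivclp_sym equivclp_trans r_into_equivclp)
qed

text \<open>\<open>A\<close> and \<open>B\<close> may share objects or arrows, so a single cylinder
  need not join them. A copy \<open>?D\<close> of \<open>A\<close> with names outside both is
  isomorphic to each and disjoint from each, and two cylinders meet there.\<close>

lemma isomorphic_equivclp:
  fixes A B :: "('o, 'm) category"
  assumes "infinite (UNIV :: 'o set)" "infinite (UNIV :: 'm set)"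
    and "finite_acyclic_category A" "finite_acyclic_category B" and inv: "inverse_functors A B F G"
  shows "equivclp finite_collapse A B"
proof -
  interpret A: finite_acyclic_category A by fact
  interpret B: finite_acyclic_category B by fact
  obtain p where p: "inj_on p (Obj A)" "p ` Obj A \<inter> (Obj A \<union> Obj B) = {}"
    using ex_fresh_injection[OF assms(1) A.finite_Obj, of "Obj A \<union> Obj B"]
      A.finite_Obj B.finite_Obj by blast
  obtain q where q: "inj_on q (Arr A)" "q ` Arr A \<inter> (Arr A \<union> Arr B) = {}"
    using ex_fresh_injection[OF assms(2) A.finite_Arr, of "Arr A \<union> Arr B"]
      A.finite_Arr B.finite_Arr by blast
  let ?T = "\<lparr>omap = p, amap = q\<rparr>"
  let ?D = "transport A ?T"
  obtain H where cat: "category ?D" and AD: "inverse_functors A ?D ?T H"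
    using transport_inverse_functors[OF A.category_axioms, of ?T] p q by auto
  have D: "finite_acyclic_category ?D"
    by (rule inverse_functors_finite_acyclic[OF assms(3) cat AD])
  have "equivclp finite_collapse A ?D"
    by (rule disjoint_isomorphic_equivclp[OF assms(2,3) D AD])
      (use p q in \<open>auto simp: Obj_transport Arr_transport\<close>)
  moreover have "equivclp finite_collapse B ?D"
    by (rule disjoint_isomorphic_equivclp[OF assms(2,4) D
          inverse_functors_comp[OF B.category_axioms A.category_axioms cat
            inverse_functors_sym[OF inv] AD]])
      (use p q in \<open>auto simp: Obj_transport Arr_transport\<close>)
  ultimately show ?thesis using equivclp_sym equivclp_trans by metis
qed

section \<open>Comparison of beat-free cores\<close>

lemma beat_free_homotopy_equivalent_isomorphic:
  assumes "finite_acyclic_category A" "\<And>x. \<not> beat_object A x"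
    and "finite_acyclic_category B" "\<And>x. \<not> beat_object B x"
    and "strongly_homotopy_equivalent A B"
  obtains F G where "inverse_functors A B F G"
proof -
  note cat = assms(1,3)[THEN finite_acyclic_category_is_category]
  obtain F G where "is_functor A B F" "is_functor B A G"
    "equivclp (natural_map A A) (comp_functor G F) id_functor"
    "equivclp (natural_map B B) (comp_functor F G) id_functor"
    using assms(5) unfolding strongly_homotopy_equivalent_iff[OF cat] by blast
  then have "inverse_functors A B F G"
    using equivclp_id_rigid[OF assms(1,2) equivclp_sym] equivclp_id_rigid[OF assms(3,4) equivclp_sym]
    by (fastforce simp: inverse_functors_def)
  then show thesis by (rule that)
qed

theorem corollary2p15:
  fixes A B :: "('o, 'm) category"
  assumes "infinite (UNIV :: 'o set)" and "infinite (UNIV :: 'm set)"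
    and "finite_acyclic_category A" and "finite_acyclic_category B"
  shows "same_strong_equivalence_type A B \<longleftrightarrow> strongly_homotopy_equivalent A B"
proof
  assume "same_strong_equivalence_type A B"
  then show "strongly_homotopy_equivalent A B"
    using equivclp_finite_collapse_homotopy_equivalent[OF assms(3)]
      same_strong_equivalence_type_iff_equivclp[OF assms(3)] by blast
next
  assume AB: "strongly_homotopy_equivalent A B"
  obtain A' where A': "strong_collapse A A'" "finite_acyclic_category A'"
    "\<And>x. \<not> beat_object A' x"
    using ex_beat_free_strong_collapse[OF assms(3)] by blast
  obtain B' where B': "strong_collapse B B'" "finite_acyclic_category B'"
    "\<And>x. \<not> beat_object B' x"
    using ex_beat_free_strong_collapse[OF assms(4)] by blast
  note cat = assms(3,4)[THEN finite_acyclic_category_is_category]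
    A'(2)[THEN finite_acyclic_category_is_category] B'(2)[THEN finite_acyclic_category_is_category]
  have "strongly_homotopy_equivalent A A'" "strongly_homotopy_equivalent B B'"
    using strong_collapse_finite_acyclic_homotopy_equivalent assms(3,4) A'(1) B'(1) by blast+
  then have "strongly_homotopy_equivalent A' B'"
    using strongly_homotopy_equivalent_trans[OF cat(3,1,2)]
      strongly_homotopy_equivalent_trans[OF cat(3,2,4)] AB strongly_homotopy_equivalent_sym by blast
  then obtain F G where "inverse_functors A' B' F G"
    using beat_free_homotopy_equivalent_isomorphic[OF A'(2,3) B'(2,3)] by blast
  then have "equivclp finite_collapse A' B'"
    by (rule isomorphic_equivclp[OF assms(1,2) A'(2) B'(2)])
  moreover have "finite_collapse A A'" "finite_collapse B B'"
    using assms A' B' by (simp_all add: finite_collapse_def)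
  ultimately have "equivclp finite_collapse A B"
    by (meson equivclp_sym equivclp_trans r_into_equivclp)
  then show "same_strong_equivalence_type A B"
    using same_strong_equivalence_type_iff_equivclp[OF assms(3)] by blast
qed

end
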